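(* Let $(L,\mathfrak{a},P,\Delta)$ be a filtered V-data and let $\Phi\in MC(\mathfrak{a}_{\Delta}^P)$. Put $P_\Phi:=P\circ e^{[\cdot,\Phi]}$. Then for all $\tilde{\Delta}\in L_1$ and $\tilde{\Phi}\in\mathfrak{a}_0$: $$\Big( [\Delta+\tilde{\Delta},\Delta+\tilde{\Delta}]=0 \ \text{ and }\ \Phi+\tilde{\Phi}\in MC(\mathfrak{a}_{\Delta+\tilde{\Delta}}^{P})\Big)\iff (\tilde{\Delta}[1],\tilde{\Phi})\in MC\big((L[1]\oplus\mathfrak{a})_{\Delta}^{P_\Phi}\big).$$ In this case, $\mathfrak{a}^P_{\Delta+\tilde{\Delta}}$ is a curved $L_\infty[1]$-algebra. It is an $L_\infty[1]$-algebra exactly when $\tilde{\Delta}\in\ker(P)$.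
   Context: Graded means $\mathbb{Z}$-graded; $V[n]_i=V_{i+n}$; for $v\in V$, $v[1]$ is the corresponding element of $V[1]$. $L_\infty[1]$-algebras. An $L_\infty[1]$-algebra is a graded vector space $W$ with linear maps $m_k=\{\cdots\}:\otimes^kW\to W$ ($k\ge1$) of degree $1$, graded symmetric ($m_n(v_{\sigma(1)},\dots,v_{\sigma(n)})=\epsilon(\sigma)m_n(v_1,\dots,v_n)$, $\epsilon$ the Koszul sign), with, for all $n\ge1$, $\sum_{i+j=n+1,\,i,j\ge1}\sum_{\sigma\in S_{(i,n-i)}}\epsilon(\sigma)m_j(m_i(v_{\sigma(1)},\dots,v_{\sigma(i)}),v_{\sigma(i+1)},\dots,v_{\sigma(n)})=0$, where $S_{(i,n-i)}$ are the $(i,n-i)$-unshuffles. A curved $L_\infty[1]$-algebra has additionally an element $m_0=\{\emptyset\}\in W_1$; $i,j=0$ are allowed in the relations and the relation for $n=0$ is added. $MC(W)$ is the set of degree $0$ elements $\alpha$ with $\sum_{n\ge1}\frac1{n!}\{\alpha,\dots,\alpha\}=0$ (sum starting at $n=0$ in the curved case); infinite sums are taken with respect to the complete filtration below. V-data. A V-data $(L,\mathfrak{a},P,\Delta)$ consists of a graded Lie algebra $L$ (bracket $[\cdot,\cdot]$ of degree $0$), an abelian graded Lie subalgebra $\mathfrak{a}$, a projection $P:L\to\mathfrak{a}$ whose kernel is a Lie subalgebra, and $\Delta\in\ker(P)_1$ with $[\Delta,\Delta]=0$. If $\Delta\in L_1$ is not required to lie in $\ker P$, it is a curved V-data. For a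 curved V-data, $\mathfrak{a}^P_\Delta$ is the curved $L_\infty[1]$-algebra on $\mathfrak{a}$ (Voronov) with $\{\emptyset\}=P\Delta$ and $\{a_1,\dots,a_n\}=P[\dots[[\Delta,a_1],a_2],\dots,a_n]$, $n\ge1$. For a V-data, $(L[1]\oplus\mathfrak{a})^P_\Delta$ is the $L_\infty[1]$-algebra (Voronov) on $L[1]\oplus\mathfrak{a}$ with brackets, where $D:=[\Delta,\cdot]$, $x,y\in L$, $a_i\in\mathfrak{a}$, $n\ge 1$: $d(x[1],a)=(-(Dx)[1],P(x+Da))$; $\{x[1],y[1]\}=(-1)^{|x|}[x,y][1]$; $\{x[1],a_1,\dots,a_n\}=P[\dots[x,a_1],\dots,a_n]$; $\{a_1,\dots,a_n\}=P[\dots[Da_1,a_2],\dots,a_n]$; all others vanish up to permutation of entries. Filtered. A complete filtration of $V$ is a descending filtration by graded subspaces $V=\mathcal{F}^{-1}V\supset\mathcal{F}^0V\supset\mathcal{F}^1V\supset\cdots$ with $V\to\varprojlim V/\mathcal{F}^nV$ an isomorphism (and $\mathcal F^kV:=V$ for $k<-1$). A (curved) V-data is filtered if $L$ has a complete filtration with (a) $[\mathcal{F}^iL,\mathcal{F}^jL]\subset\mathcal{F}^{i+j}L$, (b) $\mathfrak{a}_0\subset\mathcal{F}^1L$, (c) $P(\mathcal{F}^iL)\subset\mathcal{F}^iL$. Then for $\Phi\in\mathfrak{a}_0$ the automorphism $e^{[\cdot,\Phi]}=\sum_n\frac1{n!}[\dots[\cdot,\Phi],\dots,\Phi]$ of $L$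 is well defined, and when $\Phi\in MC(\mathfrak{a}^P_\Delta)$, $(L,\mathfrak{a},P_\Phi,\Delta)$ is again a V-data. *)

theory Defs
  imports Complex_Main "HOL-Library.Product_Plus" "HOL-Combinatorics.Permutations"
begin

text \<open>
  A graded vector space is a family of independent subspaces \<open>V i\<close> of an ambient vector space;
  its total space is their (direct) sum. The ground field is any field of characteristic 0.
\<close>

locale graded_vector_space = vector_space scale
  for scale :: "'k::field_char_0 \<Rightarrow> 'v::ab_group_add \<Rightarrow> 'v" +
  fixes V :: "int \<Rightarrow> 'v set"
  assumes subspace_component: "subspace (V i)"
    and independent_components:
      "\<lbrakk>finite I; \<And>i. i \<in> I \<Longrightarrow> f i \<in> V i; (\<Sum>i\<in>I. f i) = 0; i \<in> I\<rbrakk> \<Longrightarrow> f i = 0"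
begin

definition total :: "'v set" where
  "total = span (\<Union>i. V i)"

end

definition hom_comp :: "(int \<Rightarrow> 'v::ab_group_add set) \<Rightarrow> int \<Rightarrow> 'v \<Rightarrow> 'v" where
  "hom_comp V d v =
    (THE f. (\<forall>i. f i \<in> V i) \<and> finite {i. f i \<noteq> 0} \<and> v = (\<Sum>i | f i \<noteq> 0. f i)) d"

context graded_vector_space
begin

definition graded_subspace :: "'v set \<Rightarrow> bool" where
  "graded_subspace U \<longleftrightarrow> subspace U \<and> U \<subseteq> total \<and> (\<forall>u\<in>U. \<forall>i. hom_comp V i u \<in> U)"

end

text \<open>
  The last two assumptions say that \<open>V \<rightarrow> lim V / F n\<close> is injective and surjective, the limit being
  that of graded vector spaces, i.e. formed in each degree \<open>d\<close> separately. An element of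
  \<open>lim V d / F n\<close> is given by representatives \<open>s n\<close>.
\<close>

locale complete_filtration = graded_vector_space scale V
  for scale :: "'k::field_char_0 \<Rightarrow> 'v::ab_group_add \<Rightarrow> 'v" and V +
  fixes F :: "int \<Rightarrow> 'v set"
  assumes graded_subspace_filtration: "graded_subspace (F k)"
    and filtration_total: "k \<le> -1 \<Longrightarrow> F k = total"
    and filtration_descending: "k \<le> l \<Longrightarrow> F l \<subseteq> F k"
    and filtration_separated: "\<lbrakk>v \<in> V d; \<And>n. v \<in> F n\<rbrakk> \<Longrightarrow> v = 0"
    and filtration_complete:
      "\<lbrakk>\<And>n. s n \<in> V d; \<And>n. s (n + 1) - s n \<in> F n\<rbrakk> \<Longrightarrow> \<exists>v\<in>V d. \<forall>n. v - s n \<in> F n"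

definition filt_sums :: "(int \<Rightarrow> 'v::ab_group_add set) \<Rightarrow> (nat \<Rightarrow> 'v) \<Rightarrow> 'v \<Rightarrow> bool" where
  "filt_sums F f l \<longleftrightarrow> (\<forall>k. \<forall>\<^sub>F N in sequentially. (\<Sum>n<N. f n) - l \<in> F k)"

definition filt_suminf :: "(int \<Rightarrow> 'v::ab_group_add set) \<Rightarrow> (nat \<Rightarrow> 'v) \<Rightarrow> 'v" where
  "filt_suminf F f = (THE l. filt_sums F f l)"

definition unshuffles :: "nat \<Rightarrow> nat \<Rightarrow> (nat \<Rightarrow> nat) set" where
  "unshuffles i n =
    {\<sigma>. \<sigma> permutes {..<n} \<and> strict_mono_on {..<i} \<sigma> \<and> strict_mono_on {i..<n} \<sigma>}"

text \<open>The Koszul sign of \<open>v\<^sub>1, \<dots>, v\<^sub>n \<mapsto> v\<^bsub>\<sigma>(1)\<^esub>, \<dots>, v\<^bsub>\<sigma>(n)\<^esub>\<close>, where \<open>ds\<close> lists the degrees of the \<open>v\<^sub>i\<close>.\<close>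

definition koszul_sign :: "int list \<Rightarrow> (nat \<Rightarrow> nat) \<Rightarrow> 'k::field" where
  "koszul_sign ds \<sigma> =
    (\<Prod>(i, j)\<in>{(i, j). i < j \<and> j < length ds \<and> \<sigma> j < \<sigma> i}. (-1) powi (ds ! \<sigma> i * ds ! \<sigma> j))"

text \<open>
  All brackets are collected in one function on lists: \<open>m [v\<^sub>1, \<dots>, v\<^sub>n] = m\<^sub>n (v\<^sub>1, \<dots>, v\<^sub>n)\<close>, and
  \<open>m [] = m\<^sub>0\<close>.
\<close>

locale graded_symmetric_brackets = graded_vector_space scale V
  for scale :: "'k::field_char_0 \<Rightarrow> 'v::ab_group_add \<Rightarrow> 'v" and V +
  fixes m :: "'v list \<Rightarrow> 'v"
  assumes bracket_add:
      "\<lbrakk>set us \<subseteq> total; set vs \<subseteq> total; x \<in> total; y \<in> total\<rbrakk>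
        \<Longrightarrow> m (us @ (x + y) # vs) = m (us @ x # vs) + m (us @ y # vs)"
    and bracket_scale:
      "\<lbrakk>set us \<subseteq> total; set vs \<subseteq> total; x \<in> total\<rbrakk>
        \<Longrightarrow> m (us @ scale c x # vs) = scale c (m (us @ x # vs))"
    and bracket_degree:
      "list_all2 (\<lambda>d v. v \<in> V d) ds vs \<Longrightarrow> m vs \<in> V (sum_list ds + 1)"
    and bracket_symmetric:
      "\<lbrakk>list_all2 (\<lambda>d v. v \<in> V d) ds vs; \<sigma> permutes {..<length vs}\<rbrakk>
        \<Longrightarrow> m (permute_list \<sigma> vs) = scale (koszul_sign ds \<sigma>) (m vs)"

locale curved_Linfty1_algebra = graded_symmetric_brackets +
  assumes curved_jacobi:
      "list_all2 (\<lambda>d v. v \<in> V d) ds vs \<Longrightarrow>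
        (\<Sum>i=0..length vs. \<Sum>\<sigma>\<in>unshuffles i (length vs).
          scale (koszul_sign ds \<sigma>)
            (m (m (take i (permute_list \<sigma> vs)) # drop i (permute_list \<sigma> vs)))) = 0"

text \<open>An \<open>L\<^sub>\<infinity>[1]\<close>-algebra has no nullary bracket; this is encoded by \<open>m [] = 0\<close>.\<close>

locale Linfty1_algebra = graded_symmetric_brackets +
  assumes no_curvature: "m [] = 0"
    and jacobi:
      "\<lbrakk>list_all2 (\<lambda>d v. v \<in> V d) ds vs; length vs \<ge> 1\<rbrakk> \<Longrightarrow>
        (\<Sum>i=1..length vs. \<Sum>\<sigma>\<in>unshuffles i (length vs).
          scale (koszul_sign ds \<sigma>)
            (m (m (take i (permute_list \<sigma> vs)) # drop i (permute_list \<sigma> vs)))) = 0"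

text \<open>
  The sum starts at \<open>n = 0\<close>, as in the curved case; for an \<open>L\<^sub>\<infinity>[1]\<close>-algebra that term is \<open>0\<close>.
\<close>

definition MC ::
  "('k::field_char_0 \<Rightarrow> 'v::ab_group_add \<Rightarrow> 'v) \<Rightarrow> (int \<Rightarrow> 'v set) \<Rightarrow> (int \<Rightarrow> 'v set)
    \<Rightarrow> ('v list \<Rightarrow> 'v) \<Rightarrow> 'v set" where
  "MC scale V F m =
    {\<alpha> \<in> V 0. filt_sums F (\<lambda>n. scale (inverse (fact n)) (m (replicate n \<alpha>))) 0}"

locale graded_lie_algebra = graded_vector_space scale L
  for scale :: "'k::field_char_0 \<Rightarrow> 'v::ab_group_add \<Rightarrow> 'v" and L +
  fixes br :: "'v \<Rightarrow> 'v \<Rightarrow> 'v"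
  assumes total_UNIV: "total = UNIV"
    and br_linear_left: "Vector_Spaces.linear scale scale (\<lambda>x. br x y)"
    and br_linear_right: "Vector_Spaces.linear scale scale (\<lambda>y. br x y)"
    and br_degree: "\<lbrakk>x \<in> L i; y \<in> L j\<rbrakk> \<Longrightarrow> br x y \<in> L (i + j)"
    and br_antisymmetric: "\<lbrakk>x \<in> L i; y \<in> L j\<rbrakk> \<Longrightarrow> br x y = - scale ((-1) powi (i * j)) (br y x)"
    and br_jacobi:
      "\<lbrakk>x \<in> L i; y \<in> L j; z \<in> L k\<rbrakk>
        \<Longrightarrow> br x (br y z) = br (br x y) z + scale ((-1) powi (i * j)) (br y (br x z))"

locale curved_V_data = graded_lie_algebra scale L br
  for scale :: "'k::field_char_0 \<Rightarrow> 'v::ab_group_add \<Rightarrow> 'v" and L br +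
  fixes A :: "'v set" and P :: "'v \<Rightarrow> 'v" and \<Delta> :: 'v
  assumes graded_subspace_A: "graded_subspace A"
    and abelian: "\<lbrakk>a \<in> A; b \<in> A\<rbrakk> \<Longrightarrow> br a b = 0"
    and P_linear: "Vector_Spaces.linear scale scale P"
    and P_degree: "x \<in> L i \<Longrightarrow> P x \<in> L i"
    and P_range: "P x \<in> A"
    and P_id: "a \<in> A \<Longrightarrow> P a = a"
    and ker_P_subalgebra: "\<lbrakk>P x = 0; P y = 0\<rbrakk> \<Longrightarrow> P (br x y) = 0"
    and Delta_degree: "\<Delta> \<in> L 1"
    and Delta_square: "br \<Delta> \<Delta> = 0"

locale V_data = curved_V_data +
  assumes Delta_ker: "P \<Delta> = 0"

locale filtered_V_data =
  V_data scale L br A P \<Delta> + complete_filtration scale L F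
  for scale :: "'k::field_char_0 \<Rightarrow> 'v::ab_group_add \<Rightarrow> 'v" and L br A P \<Delta> F +
  assumes br_filtration: "\<lbrakk>x \<in> F i; y \<in> F j\<rbrakk> \<Longrightarrow> br x y \<in> F (i + j)"
    and A0_filtration: "A \<inter> L 0 \<subseteq> F 1"
    and P_filtration: "P ` F i \<subseteq> F i"

definition exp_br ::
  "('k::field_char_0 \<Rightarrow> 'v::ab_group_add \<Rightarrow> 'v) \<Rightarrow> ('v \<Rightarrow> 'v \<Rightarrow> 'v) \<Rightarrow> (int \<Rightarrow> 'v set)
    \<Rightarrow> 'v \<Rightarrow> 'v \<Rightarrow> 'v" where
  "exp_br scale br F \<Phi> x =
    filt_suminf F (\<lambda>n. scale (inverse (fact n)) (foldl br x (replicate n \<Phi>)))"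

text \<open>The brackets of \<open>\<aa>\<^sup>P\<^sub>\<Delta>\<close>: \<open>foldl br \<Delta> [a\<^sub>1, \<dots>, a\<^sub>n] = [\<dots>[[\<Delta>, a\<^sub>1], a\<^sub>2], \<dots>, a\<^sub>n]\<close>.\<close>

definition derived_brackets ::
  "('v \<Rightarrow> 'v \<Rightarrow> 'v) \<Rightarrow> ('v \<Rightarrow> 'v) \<Rightarrow> 'v \<Rightarrow> 'v list \<Rightarrow> 'v" where
  "derived_brackets br P \<Delta> as = P (foldl br \<Delta> as)"

definition sub_family :: "'v set \<Rightarrow> (int \<Rightarrow> 'v set) \<Rightarrow> int \<Rightarrow> 'v set" where
  "sub_family A V i = A \<inter> V i"

abbreviation MC_derived ::
  "('k::field_char_0 \<Rightarrow> 'v::ab_group_add \<Rightarrow> 'v) \<Rightarrow> (int \<Rightarrow> 'v set) \<Rightarrow> ('v \<Rightarrow> 'v \<Rightarrow> 'v) \<Rightarrow> 'v set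
    \<Rightarrow> (int \<Rightarrow> 'v set) \<Rightarrow> ('v \<Rightarrow> 'v) \<Rightarrow> 'v \<Rightarrow> 'v set" where
  "MC_derived scale L br A F P \<Delta> \<equiv>
    MC scale (sub_family A L) (sub_family A F) (derived_brackets br P \<Delta>)"

text \<open>
  The multilinear extension of a formula \<open>f ds vs\<close> for the value on homogeneous elements \<open>vs\<close> of
  degrees \<open>ds\<close>.
\<close>

definition graded_ext ::
  "(int \<Rightarrow> 'v::ab_group_add set) \<Rightarrow> (int list \<Rightarrow> 'v list \<Rightarrow> 'w::comm_monoid_add) \<Rightarrow> 'v list \<Rightarrow> 'w" where
  "graded_ext V f vs =
    (\<Sum>ds | list_all2 (\<lambda>d v. hom_comp V d v \<noteq> 0) ds vs. f ds (map2 (hom_comp V) ds vs))"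

text \<open>
  The graded vector space \<open>L[1] \<oplus> \<aa>\<close> consists of pairs \<open>(x, a)\<close> standing for \<open>(x[1], a)\<close>; such a
  pair is homogeneous of degree \<open>d\<close> if \<open>|x| = d + 1\<close> and \<open>|a| = d\<close>.
\<close>

definition shift_sum_grading :: "(int \<Rightarrow> 'v set) \<Rightarrow> 'v set \<Rightarrow> int \<Rightarrow> ('v \<times> 'v) set" where
  "shift_sum_grading L A d = L (d + 1) \<times> (A \<inter> L d)"

definition shift_sum_filtration :: "(int \<Rightarrow> 'v set) \<Rightarrow> 'v set \<Rightarrow> int \<Rightarrow> ('v \<times> 'v) set" where
  "shift_sum_filtration F A k = F k \<times> (A \<inter> F k)"

text \<open>
  The bracket of homogeneous \<open>w\<^sub>i = x\<^sub>i[1] + a\<^sub>i\<close> of degrees \<open>d\<^sub>i\<close>, expanded by multilinearity into the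
  given brackets. Terms with entries only in \<open>\<aa>\<close> contribute \<open>P[\<dots>[\<Delta>, a\<^sub>1], \<dots>, a\<^sub>n]\<close>. Terms with exactly
  one entry \<open>x\<^sub>i[1]\<close> contribute \<open>P[\<dots>[x\<^sub>i, a\<^sub>1], \<dots>, a\<^sub>n]\<close> (omitting \<open>a\<^sub>i\<close>), with the Koszul sign for moving
  \<open>x\<^sub>i[1]\<close> to the front. Two entries from \<open>L[1]\<close> contribute only to the binary bracket, where
  \<open>|x\<^sub>1| = d\<^sub>1 + 1\<close>.
\<close>

definition shift_sum_brackets_hom ::
  "('k::field_char_0 \<Rightarrow> 'v::ab_group_add \<Rightarrow> 'v) \<Rightarrow> ('v \<Rightarrow> 'v \<Rightarrow> 'v) \<Rightarrow> ('v \<Rightarrow> 'v) \<Rightarrow> 'v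
    \<Rightarrow> int list \<Rightarrow> ('v \<times> 'v) list \<Rightarrow> 'v \<times> 'v" where
  "shift_sum_brackets_hom scale br P \<Delta> ds ws =
    (if ws = [] then 0 else
      (case ws of
         [(x, a)] \<Rightarrow> - br \<Delta> x
       | [(x, a), (y, b)] \<Rightarrow> scale ((-1) powi (hd ds + 1)) (br x y)
       | _ \<Rightarrow> 0,
       P (foldl br \<Delta> (map snd ws)) +
       (\<Sum>i<length ws. scale ((-1) powi (ds ! i * sum_list (take i ds)))
         (P (foldl br (fst (ws ! i)) (map snd (take i ws @ drop (Suc i) ws)))))))"

definition shift_sum_brackets ::
  "('k::field_char_0 \<Rightarrow> 'v::ab_group_add \<Rightarrow> 'v) \<Rightarrow> (int \<Rightarrow> 'v set) \<Rightarrow> ('v \<Rightarrow> 'v \<Rightarrow> 'v) \<Rightarrow> 'v set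
    \<Rightarrow> ('v \<Rightarrow> 'v) \<Rightarrow> 'v \<Rightarrow> ('v \<times> 'v) list \<Rightarrow> 'v \<times> 'v" where
  "shift_sum_brackets scale L br A P \<Delta> =
    graded_ext (shift_sum_grading L A) (shift_sum_brackets_hom scale br P \<Delta>)"

abbreviation MC_shift_sum ::
  "('k::field_char_0 \<Rightarrow> 'v::ab_group_add \<Rightarrow> 'v) \<Rightarrow> (int \<Rightarrow> 'v set) \<Rightarrow> ('v \<Rightarrow> 'v \<Rightarrow> 'v) \<Rightarrow> 'v set
    \<Rightarrow> (int \<Rightarrow> 'v set) \<Rightarrow> ('v \<Rightarrow> 'v) \<Rightarrow> 'v \<Rightarrow> ('v \<times> 'v) set" where
  "MC_shift_sum scale L br A F P \<Delta> \<equiv>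
    MC (\<lambda>c. map_prod (scale c) (scale c)) (shift_sum_grading L A) (shift_sum_filtration F A)
      (shift_sum_brackets scale L br A P \<Delta>)"

end

theory Submission imports Defs
begin

text \<open>
  As \<open>[\<Phi>, \<Phi>'] = 0\<close>, the automorphisms \<open>e\<^bsup>[\<cdot>,\<Phi>]\<^esup>\<close> and \<open>e\<^bsup>[\<cdot>,\<Phi>']\<^esup>\<close> compose to \<open>e\<^bsup>[\<cdot>,\<Phi>+\<Phi>']\<^esup>\<close>, and
  \<open>P e\<^bsup>[\<cdot>,\<Phi>]\<^esup> \<Delta> = 0\<close> says that \<open>\<Phi>\<close> is Maurer-Cartan. Hence the two components of the Maurer-Cartan
  series of \<open>(\<Delta>'[1], \<Phi>')\<close> have the sums \<open>- 1/2 [\<Delta> + \<Delta>', \<Delta> + \<Delta>']\<close> and \<open>P e\<^bsup>[\<cdot>,\<Phi>+\<Phi>']\<^esup> (\<Delta> + \<Delta>')\<close>, and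
  the latter vanishes iff \<open>\<Phi> + \<Phi>'\<close> is Maurer-Cartan for \<open>\<Delta> + \<Delta>'\<close>.

  The Jacobi identities of the derived brackets come from expanding
  \<open>P [\<dots>[[\<Delta>, \<Delta>], a\<^sub>1], \<dots>, a\<^sub>n] = 0\<close> with the Leibniz rule into a signed sum of \<open>P [\<Delta>\<^sub>S, \<Delta>\<^sub>T]\<close> over
  the partitions \<open>S \<union> T = {1, \<dots>, n}\<close>, where \<open>\<Delta>\<^sub>S\<close> is the iterated bracket of \<open>\<Delta>\<close> with the \<open>a\<^sub>i\<close>,
  \<open>i \<in> S\<close>. Since \<open>ker P\<close> is a subalgebra and \<open>\<aa>\<close> is abelian,
  \<open>P [x, y] = P [P x, y] + P [x, P y]\<close>, so each \<open>P [\<Delta>\<^sub>S, \<Delta>\<^sub>T]\<close> is the sum of the Jacobi terms of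
  \<open>(S, T)\<close> and of \<open>(T, S)\<close>, and the expansion is twice the Jacobi expression.
\<close>

section \<open>Koszul signs and unshuffles\<close>

lemma minus_one_powi: "(- 1 :: 'k::field) powi k = (if even k then 1 else - 1)"
  by (cases "even k") (auto elim!: evenE oddE simp: power_int_add power_int_mult)

lemma minus_one_powi_sum:
  "finite X \<Longrightarrow> (- 1 :: 'k::field) powi (\<Sum>x\<in>X. f x) = (\<Prod>x\<in>X. (- 1) powi f x)"
  by (induction X rule: finite_induct) (simp_all add: power_int_add)

text \<open>
  Signs are kept as integer exponents of \<open>- 1\<close>, so that comparing them is a matter of parity.
  Entries are indexed by \<open>nat\<close>, with degrees \<open>d\<close>, and a permutation is the list of its values.
\<close>

fun inv_exp :: "(nat \<Rightarrow> int) \<Rightarrow> nat list \<Rightarrow> int" where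
  "inv_exp d [] = 0"
| "inv_exp d (k # ks) = (\<Sum>q\<leftarrow>ks. if q < k then d k * d q else 0) + inv_exp d ks"

text \<open>An inversion of \<open>k # ks\<close> either starts at the head or is an inversion of
  \<open>ks\<close> shifted by one. This matches the recursion with the index set in
  \<open>koszul_sign\<close>.\<close>

lemma inv_exp_eq_sum_inversions:
  "inv_exp d ks =
    (\<Sum>(i, j)\<in>{(i, j). i < j \<and> j < length ks \<and> ks ! j < ks ! i}. d (ks ! i) * d (ks ! j))"
proof (induction ks)
  case Nil
  then show ?case by simp
next
  case (Cons k ks)
  define I where "I = {(i, j). i < j \<and> j < length ks \<and> ks ! j < ks ! i}"
  define J where "J = {j. j < length ks \<and> ks ! j < k}"
  have fin: "finite I" "finite J"
    unfolding I_def J_def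
    by (auto intro: finite_subset[of _ "{..<length ks} \<times> {..<length ks}"])
  have inj: "inj_on (\<lambda>j. (0 :: nat, Suc j)) J" "inj_on (map_prod Suc Suc) I"
    by (auto simp: inj_on_def)
  have split: "{(i, j). i < j \<and> j < length (k # ks) \<and> (k # ks) ! j < (k # ks) ! i}
      = (\<lambda>j. (0, Suc j)) ` J \<union> map_prod Suc Suc ` I" (is "?K = ?R")
  proof (intro equalityI subsetI)
    fix x assume "x \<in> ?K"
    then obtain i j where x: "x = (i, j)" "i < j" "j < length (k # ks)"
      "(k # ks) ! j < (k # ks) ! i" by auto
    then obtain j' where j: "j = Suc j'" by (cases j) auto
    show "x \<in> ?R"
    proof (cases i)
      case 0
      then show ?thesis using x j by (auto simp: J_def)
    next
      case (Suc i')
      then have "(i', j') \<in> I" using x j by (auto simp: I_def)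
      then show ?thesis using x j Suc by (auto intro!: image_eqI[of _ _ "(i', j')"])
    qed
  qed (auto simp: I_def J_def)
  have "(\<Sum>(i, j)\<in>?K. d ((k # ks) ! i) * d ((k # ks) ! j))
      = (\<Sum>j\<in>J. d k * d (ks ! j)) + (\<Sum>(i, j)\<in>I. d (ks ! i) * d (ks ! j))"
    unfolding split
    by (subst sum.union_disjoint)
      (use fin in \<open>auto simp: sum.reindex[OF inj(1)] sum.reindex[OF inj(2)] case_prod_unfold\<close>)
  also have "(\<Sum>j\<in>J. d k * d (ks ! j)) = (\<Sum>q\<leftarrow>ks. if q < k then d k * d q else 0)"
    unfolding sum_list_sum_nth J_def
    by (auto simp: sum.If_cases intro!: sum.mono_neutral_cong_left)
  finally show ?case using Cons by (simp add: I_def)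
qed

lemma koszul_sign_eq_inv_exp:
  assumes "\<sigma> permutes {..<length ds}"
  shows "koszul_sign ds \<sigma> = (- 1 :: 'k::field) powi inv_exp (nth ds) (map \<sigma> [0..<length ds])"
proof -
  let ?I = "{(i, j). i < j \<and> j < length ds \<and> \<sigma> j < \<sigma> i}"
  have "finite ?I"
    by (rule finite_subset[of _ "{..<length ds} \<times> {..<length ds}"]) auto
  moreover have "inv_exp (nth ds) (map \<sigma> [0..<length ds]) = (\<Sum>(i, j)\<in>?I. ds ! \<sigma> i * ds ! \<sigma> j)"
    unfolding inv_exp_eq_sum_inversions
    by (rule sum.cong) auto
  ultimately show ?thesis
    by (simp add: koszul_sign_def minus_one_powi_sum case_prod_unfold)
qed

text \<open>The exponent of the Koszul sign of the unshuffle listing \<open>S\<close> before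
  \<open>T\<close>: its inversions are the pairs of \<open>p\<close> in \<open>S\<close> and a
  smaller \<open>q\<close> in \<open>T\<close>.\<close>

definition shuffle_exp :: "(nat \<Rightarrow> int) \<Rightarrow> nat set \<Rightarrow> nat set \<Rightarrow> int" where
  "shuffle_exp d S T = (\<Sum>p\<in>S. \<Sum>q\<in>T \<inter> {..<p}. d p * d q)"

text \<open>A new largest index forms no inversion when it joins the right block, but is inverted
  with all of \<open>T\<close> when it joins the left one (\<open>shuffle_exp_insert_left\<close>).
  These are the two cases in the induction of \<open>foldl_br_leibniz\<close>.\<close>

lemma shuffle_exp_insert_right:
  assumes "S \<subseteq> {..<n}"
  shows "shuffle_exp d S (insert n T) = shuffle_exp d S T"
proof -
  have "insert n T \<inter> {..<p} = T \<inter> {..<p}" if "p \<in> S" for p using that assms by auto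
  then show ?thesis by (simp add: shuffle_exp_def)
qed

lemma shuffle_exp_insert_left:
  assumes "S \<subseteq> {..<n}" "T \<subseteq> {..<n}"
  shows "shuffle_exp d (insert n S) T = shuffle_exp d S T + d n * sum d T"
proof -
  have "T \<inter> {..<n} = T" "n \<notin> S" "finite S" using assms by (auto intro: finite_subset)
  then show ?thesis by (simp add: shuffle_exp_def sum_distrib_left)
qed

text \<open>As \<open>S\<close> and \<open>T\<close> are disjoint, each pair in
  \<open>S \<times> T\<close> is inverted in exactly one of the two orders.\<close>

lemma shuffle_exp_swap:
  assumes "finite S" "finite T" "S \<inter> T = {}"
  shows "shuffle_exp d S T + shuffle_exp d T S = sum d S * sum d T"
proof -
  have 1: "shuffle_exp d S T = (\<Sum>p\<in>S. \<Sum>q\<in>T. if q < p then d p * d q else 0)" 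
    if "finite T" for S T
    unfolding shuffle_exp_def
    by (auto simp: that sum.If_cases intro!: sum.cong)
  have "shuffle_exp d T S = (\<Sum>p\<in>S. \<Sum>q\<in>T. if p < q then d p * d q else 0)"
    unfolding 1[OF assms(1)] by (subst sum.swap) (simp add: mult.commute cong: if_cong)
  then have "shuffle_exp d S T + shuffle_exp d T S = (\<Sum>p\<in>S. \<Sum>q\<in>T. d p * d q)"
    unfolding 1[OF assms(2)] using assms(3)
    by (auto simp: sum.distrib[symmetric] intro!: sum.cong)
  then show ?thesis by (simp add: sum_product)
qed

lemma sum_list_map_eq_0: "(\<And>x. x \<in> set xs \<Longrightarrow> f x = 0) \<Longrightarrow> sum_list (map f xs) = 0"
  by (induction xs) auto

lemma inv_exp_sorted: "sorted ks \<Longrightarrow> inv_exp d ks = 0"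
  by (induction ks) (auto intro!: sum_list_map_eq_0)

text \<open>Increasing blocks have no inner inversions, so only pairs across the two blocks
  remain.\<close>

lemma inv_exp_append:
  assumes "sorted_wrt (<) xs" "sorted_wrt (<) ys"
  shows "inv_exp d (xs @ ys) = shuffle_exp d (set xs) (set ys)"
  using assms(1)
proof (induction xs)
  case Nil
  then show ?case using assms(2)
    by (simp add: shuffle_exp_def inv_exp_sorted strict_sorted_imp_sorted)
next
  case (Cons x xs)
  have "(\<Sum>q\<leftarrow>xs. if q < x then d x * d q else 0) = 0"
    using Cons.prems by (intro sum_list_map_eq_0) auto
  moreover have "(\<Sum>q\<leftarrow>ys. if q < x then d x * d q else 0) = (\<Sum>q\<in>set ys \<inter> {..<x}. d x * d q)"
    using assms(2)
    by (subst sum_list_distinct_conv_sum_set)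
      (auto simp: sum.If_cases strict_sorted_iff intro!: sum.cong)
  moreover have "x \<notin> set xs" using Cons.prems by auto
  ultimately show ?case using Cons by (simp add: shuffle_exp_def)
qed

text \<open>An unshuffle is increasing on both blocks, so it is determined by the image
  \<open>S\<close> of its first block, and \<open>i = card S\<close>.\<close>

lemma sum_unshuffles:
  fixes G :: "nat list \<Rightarrow> nat list \<Rightarrow> 'a::comm_monoid_add"
  shows "(\<Sum>i=0..n. \<Sum>\<sigma>\<in>unshuffles i n. G (map \<sigma> [0..<i]) (map \<sigma> [i..<n]))
    = (\<Sum>S\<in>Pow {..<n}. G (sorted_list_of_set S) (sorted_list_of_set ({..<n} - S)))"
proof -
  have fin: "finite (unshuffles i n)" for i
    by (rule finite_subset[OF _ finite_permutations[of "{..<n}"]]) (auto simp: unshuffles_def)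
  \<comment> \<open>The unshuffle recovered from \<open>S\<close>; it fixes every
    \<open>k \<ge> n\<close>, as \<open>permutes\<close> demands.\<close>
  define \<tau> where "\<tau> = (\<lambda>S k. if k < n
    then (sorted_list_of_set S @ sorted_list_of_set ({..<n} - S)) ! k else k)"
  have lists: "map \<sigma> [0..<i] = sorted_list_of_set (\<sigma> ` {..<i})"
      "map \<sigma> [i..<n] = sorted_list_of_set ({..<n} - \<sigma> ` {..<i})"
      "\<sigma> ` {..<i} \<subseteq> {..<n}" "card (\<sigma> ` {..<i}) = i"
    if "i \<le> n" and \<sigma>: "\<sigma> \<in> unshuffles i n" for i \<sigma>
  proof -
    have perm: "\<sigma> permutes {..<n}" and mono: "strict_mono_on {..<i} \<sigma>" "strict_mono_on {i..<n} \<sigma>"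
      using \<sigma> by (auto simp: unshuffles_def)
    \<comment> \<open>An increasing list is determined by its set of entries, so both blocks are the
      sorted lists of their images.\<close>
    have sorted: "sorted_wrt (<) (map \<sigma> [0..<i])" "sorted_wrt (<) (map \<sigma> [i..<n])"
      using strict_mono_onD[OF mono(1)] strict_mono_onD[OF mono(2)]
      by (auto simp: sorted_wrt_iff_nth_less)
    have "{i..<n} = {..<n} - {..<i}" by auto
    then have "\<sigma> ` {i..<n} = {..<n} - \<sigma> ` {..<i}"
      by (simp only: image_set_diff[OF permutes_inj[OF perm]] permutes_image[OF perm])
    then have "sorted_list_of_set ({..<n} - \<sigma> ` {..<i}) = sorted_list_of_set (set (map \<sigma> [i..<n]))"
      by simp
    then show "map \<sigma> [i..<n] = sorted_list_of_set ({..<n} - \<sigma> ` {..<i})"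
      using sorted(2) by (metis sorted_list_of_set.idem_if_sorted_distinct strict_sorted_iff)
    have "sorted_list_of_set (\<sigma> ` {..<i}) = sorted_list_of_set (set (map \<sigma> [0..<i]))"
      by (simp add: atLeast0LessThan)
    then show "map \<sigma> [0..<i] = sorted_list_of_set (\<sigma> ` {..<i})"
      using sorted(1) by (metis sorted_list_of_set.idem_if_sorted_distinct strict_sorted_iff)
    show "\<sigma> ` {..<i} \<subseteq> {..<n}"
      using permutes_image[OF perm] that by auto
    show "card (\<sigma> ` {..<i}) = i"
      using permutes_inj[OF perm] by (simp add: card_image inj_on_def inj_def)
  qed
  have tau: "\<tau> S \<in> unshuffles (card S) n" "\<tau> S ` {..<card S} = S" "card S \<le> n" if "S \<subseteq> {..<n}" for S
  proof -
    let ?l = "sorted_list_of_set S @ sorted_list_of_set ({..<n} - S)"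
    have fS: "finite S" using that by (rule finite_subset) simp
    have cardS: "card S \<le> n" using card_mono[OF _ that] by simp
    have len: "length ?l = n"
      using fS that cardS by (simp add: card_Diff_subset)
    have set_l: "set ?l = {..<n}" using fS that by auto
    have "distinct ?l" using fS by auto
    then have "bij_betw ((!) ?l) {..<n} {..<n}"
      using len set_l by (intro bij_betw_nth) auto
    then have "bij_betw (\<tau> S) {..<n} {..<n}"
      by (rule bij_betw_cong[THEN iffD1, rotated]) (simp add: \<tau>_def)
    then have perm: "\<tau> S permutes {..<n}"
      by (rule bij_imp_permutes) (simp add: \<tau>_def)
    have t1: "\<tau> S k = sorted_list_of_set S ! k" if "k < card S" for k
      using that cardS fS by (simp add: \<tau>_def nth_append)
    have t2: "\<tau> S k = sorted_list_of_set ({..<n} - S) ! (k - card S)" if "card S \<le> k" "k < n" for k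
      using that fS by (simp add: \<tau>_def nth_append)
    have "strict_mono_on {..<card S} (\<tau> S)"
      using sorted_wrt_nth_less[OF strict_sorted_list_of_set, of _ _ S]
      by (auto simp: strict_mono_on_def t1)
    moreover have "strict_mono_on {card S..<n} (\<tau> S)"
      using sorted_wrt_nth_less[OF strict_sorted_list_of_set, of _ _ "{..<n} - S"] fS that
      by (auto simp: strict_mono_on_def t2 card_Diff_subset)
    ultimately show "\<tau> S \<in> unshuffles (card S) n" using perm by (simp add: unshuffles_def)
    have "\<tau> S ` {..<card S} = (!) (sorted_list_of_set S) ` {..<length (sorted_list_of_set S)}"
      by (simp add: t1)
    also have "\<dots> = set (sorted_list_of_set S)" by (auto simp: set_conv_nth)
    finally show "\<tau> S ` {..<card S} = S" using fS by simp
    show "card S \<le> n" by (rule cardS)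
  qed
  have tau_inv: "\<tau> (\<sigma> ` {..<i}) = \<sigma>" if "i \<le> n" "\<sigma> \<in> unshuffles i n" for i \<sigma>
  proof
    fix k
    have app: "map \<sigma> [0..<i] @ map \<sigma> [i..<n] = map \<sigma> [0..<n]"
      using that(1) by (metis le0 map_append upt_add_eq_append le_add_diff_inverse)
    show "\<tau> (\<sigma> ` {..<i}) k = \<sigma> k"
    proof (cases "k < n")
      case True
      then show ?thesis by (simp add: \<tau>_def lists(1,2)[OF that, symmetric] app)
    next
      case False
      then show ?thesis using that by (auto simp: \<tau>_def unshuffles_def permutes_def)
    qed
  qed
  have in_range: "\<sigma> k < n" if "i \<le> n" "\<sigma> \<in> unshuffles i n" "k < i" for i \<sigma> k
    using lists(3)[OF that(1,2)] that(3) by auto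
  have "(\<Sum>i=0..n. \<Sum>\<sigma>\<in>unshuffles i n. G (map \<sigma> [0..<i]) (map \<sigma> [i..<n]))
    = (\<Sum>(i, \<sigma>)\<in>(SIGMA i:{0..n}. unshuffles i n). G (map \<sigma> [0..<i]) (map \<sigma> [i..<n]))"
    by (rule sum.Sigma) (simp_all add: fin)
  also have "\<dots> = (\<Sum>S\<in>Pow {..<n}. G (sorted_list_of_set S) (sorted_list_of_set ({..<n} - S)))"
    by (rule sum.reindex_bij_witness[where i = "\<lambda>S. (card S, \<tau> S)" and j = "\<lambda>(i, \<sigma>). \<sigma> ` {..<i}"])
      (use tau tau_inv in_range in \<open>auto simp: lists(1,2,4)\<close>)
  finally show ?thesis .
qed

section \<open>Derived brackets\<close>

context graded_lie_algebra
begin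

lemma br_add_left: "br (x + y) z = br x z + br y z"
proof -
  interpret Vector_Spaces.linear scale scale "\<lambda>x. br x z" by (rule br_linear_left)
  show ?thesis by (rule add)
qed

lemma br_add_right: "br x (y + z) = br x y + br x z"
proof -
  interpret Vector_Spaces.linear scale scale "br x" by (rule br_linear_right)
  show ?thesis by (rule add)
qed

lemma br_scale_left: "br (scale c x) y = scale c (br x y)"
proof -
  interpret Vector_Spaces.linear scale scale "\<lambda>x. br x y" by (rule br_linear_left)
  show ?thesis by (rule scale)
qed

lemma br_scale_right: "br x (scale c y) = scale c (br x y)"
proof -
  interpret Vector_Spaces.linear scale scale "br x" by (rule br_linear_right)
  show ?thesis by (rule scale)
qed

lemma br_zero_left [simp]: "br 0 y = 0"
  using br_scale_left[of 0 0 y] by simp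

lemma br_zero_right [simp]: "br x 0 = 0"
  using br_scale_right[of x 0 0] by simp

lemma br_sum_left: "br (sum f I) y = (\<Sum>i\<in>I. br (f i) y)"
  by (induction I rule: infinite_finite_induct) (simp_all add: br_add_left)

text \<open>Iterated brackets grow on the right, so the Jacobi identity is needed as a Leibniz rule
  for bracketing with \<open>z\<close> from the right; antisymmetry turns \<open>[y, [x, z]]\<close>
  into \<open>[[x, z], y]\<close>.\<close>

lemma br_right_leibniz:
  assumes "x \<in> L i" "y \<in> L j" "z \<in> L k"
  shows "br (br x y) z = br x (br y z) + scale ((- 1) powi (j * k)) (br (br x z) y)"
proof -
  have "br y (br x z) = - scale ((- 1) powi (j * (i + k))) (br (br x z) y)"
    using assms by (intro br_antisymmetric br_degree)
  moreover have "br x (br y z) = br (br x y) z + scale ((- 1) powi (i * j)) (br y (br x z))"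
    using assms by (rule br_jacobi)
  ultimately show ?thesis
    by (auto simp: minus_one_powi)
qed

lemma foldl_br_add: "foldl br (x + y) vs = foldl br x vs + foldl br y vs"
  by (induction vs arbitrary: x y) (simp_all add: br_add_left)

lemma foldl_br_scale: "foldl br (scale c x) vs = scale c (foldl br x vs)"
  by (induction vs arbitrary: x) (simp_all add: br_scale_left)

lemma foldl_br_zero [simp]: "foldl br 0 vs = 0"
  by (induction vs) simp_all

lemma foldl_br_degree:
  "\<lbrakk>list_all2 (\<lambda>d v. v \<in> L d) ds vs; x \<in> L i\<rbrakk> \<Longrightarrow> foldl br x vs \<in> L (i + sum_list ds)"
proof (induction ds vs arbitrary: x i rule: list_all2_induct)
  case (Cons d ds v vs)
  then show ?case using Cons.IH[OF br_degree[OF Cons.prems]] Cons.hyps br_degree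
    by (metis (no_types, lifting) add.assoc foldl_Cons sum_list.Cons)
qed simp

lemma foldl_br_map_degree:
  assumes "\<And>k. k \<in> set ks \<Longrightarrow> a k \<in> L (d k)" "x \<in> L i"
  shows "foldl br x (map a ks) \<in> L (i + (\<Sum>k\<leftarrow>ks. d k))"
proof -
  have "list_all2 (\<lambda>d v. v \<in> L d) (map d ks) (map a ks)"
    using assms(1) by (auto simp: list_all2_conv_all_nth)
  then show ?thesis using foldl_br_degree assms(2) by blast
qed

lemma foldl_br_sorted_degree:
  assumes "\<And>k. k \<in> S \<Longrightarrow> a k \<in> L (d k)" "x \<in> L i" "finite S"
  shows "foldl br x (map a (sorted_list_of_set S)) \<in> L (i + sum d S)"
  using foldl_br_map_degree[of "sorted_list_of_set S" a d x i] assms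
  by (simp add: sum_list_distinct_conv_sum_set)

text \<open>Each \<open>a k\<close> is absorbed by \<open>x\<close> (when \<open>k \<in> S\<close>)
  or by \<open>y\<close>. To reach \<open>x\<close> it must cross \<open>y\<close>, which gives
  \<open>j * sum d S\<close>, and the entries of smaller index that \<open>y\<close> has already
  absorbed, which gives the shuffle exponent.\<close>

lemma foldl_br_leibniz:
  assumes x: "x \<in> L i" and y: "y \<in> L j" and a: "\<And>k. k < n \<Longrightarrow> a k \<in> L (d k)"
  shows "foldl br (br x y) (map a [0..<n]) =
    (\<Sum>S\<in>Pow {..<n}. scale ((- 1) powi (shuffle_exp d S ({..<n} - S) + j * sum d S))
      (br (foldl br x (map a (sorted_list_of_set S)))
        (foldl br y (map a (sorted_list_of_set ({..<n} - S))))))"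
    (is "_ = (\<Sum>S\<in>_. ?f n S)")
  using a
proof (induction n)
  case 0
  then show ?case by (simp add: shuffle_exp_def)
next
  case (Suc n)
  define X where "X S = foldl br x (map a (sorted_list_of_set S))" for S
  define Y where "Y S = foldl br y (map a (sorted_list_of_set S))" for S
  have slos: "sorted_list_of_set (insert n S) = sorted_list_of_set S @ [n]" if "S \<subseteq> {..<n}" for S
  proof -
    have "finite S" using that by (rule finite_subset) simp
    then have "set (sorted_list_of_set S @ [n]) = insert n S"
        "sorted_wrt (<) (sorted_list_of_set S @ [n])"
      using that by (auto simp: sorted_wrt_append)
    then show ?thesis
      by (metis sorted_list_of_set.idem_if_sorted_distinct strict_sorted_iff)
  qed
  \<comment> \<open>Bracketing with \<open>a n\<close> yields one term for each factor that can
    absorb it; these are the summands of \<open>S\<close> and of \<open>insert n S\<close> for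
    \<open>Suc n\<close>.\<close>
  have step: "br (?f n S) (a n) = ?f (Suc n) S + ?f (Suc n) (insert n S)" if "S \<in> Pow {..<n}" for S
  proof -
    define T where "T = {..<n} - S"
    have S: "S \<subseteq> {..<n}" "T \<subseteq> {..<n}" "finite S" "finite T" "n \<notin> S"
      using that by (auto simp: T_def intro: finite_subset)
    have XY: "X S \<in> L (i + sum d S)" "Y T \<in> L (j + sum d T)"
      using S Suc.prems x y unfolding X_def Y_def
      by (auto intro!: foldl_br_sorted_degree)
    have ins: "X (insert n S) = br (X S) (a n)" "Y (insert n T) = br (Y T) (a n)"
      by (simp_all only: X_def Y_def slos[OF S(1)] slos[OF S(2)] map_append list.map foldl_append foldl.simps)
    have compl: "{..<Suc n} - S = insert n T" "{..<Suc n} - insert n S = T"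
      using S by (auto simp: T_def)
    have "br (br (X S) (Y T)) (a n) = br (X S) (br (Y T) (a n))
        + scale ((- 1) powi ((j + sum d T) * d n)) (br (br (X S) (a n)) (Y T))"
      using XY Suc.prems by (intro br_right_leibniz) auto
    then show ?thesis
      using S unfolding X_def[symmetric] Y_def[symmetric] compl T_def[symmetric] ins
      by (simp add: br_scale_left scale_right_distrib shuffle_exp_insert_right
          shuffle_exp_insert_left power_int_add[symmetric] algebra_simps)
  qed
  have inj: "inj_on (insert n) (Pow {..<n})"
    by (rule inj_onI) (metis Diff_insert_absorb PowD lessThan_iff less_irrefl subsetD)
  have "foldl br (br x y) (map a [0..<Suc n]) = (\<Sum>S\<in>Pow {..<n}. br (?f n S) (a n))"
    using Suc by (simp add: br_sum_left)
  also have "\<dots> = (\<Sum>S\<in>Pow {..<n}. ?f (Suc n) S) + (\<Sum>S\<in>insert n ` Pow {..<n}. ?f (Suc n) S)"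
    using step by (simp add: sum.distrib sum.reindex[OF inj])
  also have "\<dots> = (\<Sum>S\<in>Pow {..<n} \<union> insert n ` Pow {..<n}. ?f (Suc n) S)"
    by (rule sum.union_disjoint[symmetric]) auto
  also have "Pow {..<n} \<union> insert n ` Pow {..<n} = Pow {..<Suc n}"
    by (simp only: lessThan_Suc Pow_insert)
  finally show ?case .
qed

end

lemma permute_list_conv_map: "permute_list \<sigma> vs = map (nth vs) (map \<sigma> [0..<length vs])"
  by (simp add: permute_list_def)

lemma (in graded_symmetric_brackets) brackets_head_zero:
  assumes "set vs \<subseteq> total"
  shows "m (0 # vs) = 0"
proof -
  have "0 \<in> total" by (simp add: total_def span_zero)
  then show ?thesis using bracket_scale[of "[]" vs 0 0] assms by simp
qed

lemma (in graded_vector_space) component_subset_total: "V i \<subseteq> total"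
  unfolding total_def using span_superset by fastforce

text \<open>The two Jacobi sums differ by the terms with \<open>i = 0\<close>, in which
  \<open>m []\<close> is an entry; if \<open>m [] = 0\<close>, linearity kills them.\<close>

lemma (in curved_Linfty1_algebra) Linfty1_algebra_iff_no_curvature:
  "Linfty1_algebra scale V m \<longleftrightarrow> m [] = 0"
proof
  assume "Linfty1_algebra scale V m"
  then show "m [] = 0" by (rule Linfty1_algebra.no_curvature)
next
  assume m0: "m [] = 0"
  show "Linfty1_algebra scale V m"
  proof unfold_locales
    fix ds vs
    assume vs: "list_all2 (\<lambda>d v. v \<in> V d) ds vs"
    let ?f = "\<lambda>i \<sigma>. scale (koszul_sign ds \<sigma>)
      (m (m (take i (permute_list \<sigma> vs)) # drop i (permute_list \<sigma> vs)))"
    have tot: "set vs \<subseteq> total"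
      using vs component_subset_total by (fastforce simp: list_all2_conv_all_nth set_conv_nth)
    have "?f 0 \<sigma> = 0" if "\<sigma> \<in> unshuffles 0 (length vs)" for \<sigma>
    proof -
      have "\<sigma> permutes {..<length vs}" using that by (simp add: unshuffles_def)
      then have "set (permute_list \<sigma> vs) = set vs" by simp
      then show ?thesis using tot by (simp add: m0 brackets_head_zero)
    qed
    then have "(\<Sum>\<sigma>\<in>unshuffles 0 (length vs). ?f 0 \<sigma>) = 0"
      by (intro sum.neutral) blast
    then have "(\<Sum>i=1..length vs. \<Sum>\<sigma>\<in>unshuffles i (length vs). ?f i \<sigma>)
      = (\<Sum>i=0..length vs. \<Sum>\<sigma>\<in>unshuffles i (length vs). ?f i \<sigma>)"
      by (simp add: sum.atLeast_Suc_atMost)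
    then show "(\<Sum>i=1..length vs. \<Sum>\<sigma>\<in>unshuffles i (length vs). ?f i \<sigma>) = 0"
      using curved_jacobi[OF vs] by simp
  qed (rule m0)
qed

section \<open>Voronov's brackets on the abelian subalgebra: symmetry and Jacobi identities\<close>

context curved_V_data
begin

lemma P_add: "P (x + y) = P x + P y"
proof -
  interpret Vector_Spaces.linear scale scale P by (rule P_linear)
  show ?thesis by (rule add)
qed

lemma P_scale: "P (scale c x) = scale c (P x)"
proof -
  interpret Vector_Spaces.linear scale scale P by (rule P_linear)
  show ?thesis by (rule scale)
qed

lemma P_zero [simp]: "P 0 = 0"
  using P_scale[of 0 0] by simp

lemma P_sum: "P (sum f I) = (\<Sum>i\<in>I. P (f i))"
  by (induction I rule: infinite_finite_induct) (simp_all add: P_add)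

lemma P_minus: "P (- x) = - P x"
  using P_scale[of "- 1" x] by simp

lemma P_diff: "P (x - y) = P x - P y"
  using P_add[of x "- y"] by (simp add: P_minus)

lemma subspace_A: "subspace A"
  using graded_subspace_A by (simp add: graded_subspace_def)

lemma P_br: "P (br x y) = P (br (P x) y) + P (br x (P y))"
proof -
  \<comment> \<open>Split \<open>x = u + p\<close> and \<open>y = v + q\<close> along kernel and
    image of \<open>P\<close>. Of the four brackets, \<open>[u, v]\<close> stays in the kernel and
    \<open>[p, q]\<close> vanishes.\<close>
  define u v p q where "u = x - P x" and "v = y - P y" and "p = P x" and "q = P y"
  have "P (br u v) = 0"
    unfolding u_def v_def by (rule ker_P_subalgebra) (simp_all add: P_diff P_id P_range)
  moreover have "br p q = 0" unfolding p_def q_def by (intro abelian P_range)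
  ultimately have "P (br (u + p) (v + q)) = P (br p (v + q)) + P (br (u + p) q)"
    by (simp add: br_add_left br_add_right P_add)
  then show ?thesis by (simp add: u_def v_def p_def q_def)
qed

text \<open>Because \<open>[a, b] = 0\<close>, one term of the Leibniz rule drops out, and
  neighbouring entries of an iterated bracket commute up to their Koszul sign.\<close>

lemma br_swap:
  assumes "x \<in> L i" "a \<in> A \<inter> L p" "b \<in> A \<inter> L q"
  shows "br (br x a) b = scale ((- 1) powi (p * q)) (br (br x b) a)"
proof -
  have "br (br x a) b = br x (br a b) + scale ((- 1) powi (p * q)) (br (br x b) a)"
    using assms by (intro br_right_leibniz) auto
  moreover have "br a b = 0" using assms by (intro abelian) auto
  ultimately show ?thesis by simp
qed

text \<open>In a Jacobi term the inner bracket is the first entry of the outer one. Moved to the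
  last place, it exposes the form \<open>[X, P Y]\<close> that occurs in
  \<open>P_br\<close>.\<close>

lemma foldl_br_move:
  assumes "x \<in> L i" "b \<in> A \<inter> L p" "\<And>k. k \<in> set ks \<Longrightarrow> a k \<in> A \<inter> L (d k)"
  shows "foldl br (br x b) (map a ks)
    = scale ((- 1) powi (p * (\<Sum>k\<leftarrow>ks. d k))) (br (foldl br x (map a ks)) b)"
  using assms
proof (induction ks arbitrary: x i)
  case Nil
  then show ?case by simp
next
  case (Cons k ks)
  have "br (br x b) (a k) = scale ((- 1) powi (p * d k)) (br (br x (a k)) b)"
    using Cons.prems by (intro br_swap) auto
  moreover have "br x (a k) \<in> L (i + d k)" using Cons.prems by (auto intro: br_degree)
  ultimately show ?case
    using Cons.IH[of "br x (a k)"] Cons.prems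
    by (simp add: foldl_br_scale power_int_add[symmetric] distrib_left)
qed

lemma foldl_br_insort:
  assumes "x \<in> L i" "sorted ks" "\<And>q. q \<in> insert k (set ks) \<Longrightarrow> a q \<in> A \<inter> L (d q)"
  shows "foldl br x (map a (k # ks))
    = scale ((- 1) powi (\<Sum>q\<leftarrow>ks. if q < k then d k * d q else 0)) (foldl br x (map a (insort k ks)))"
  using assms
proof (induction ks arbitrary: x i)
  case Nil
  then show ?case by simp
next
  case (Cons y ks)
  show ?case
  proof (cases "k \<le> y")
    case True
    have "(\<Sum>q\<leftarrow>y # ks. if q < k then d k * d q else 0) = 0"
      using True Cons.prems(2) by (intro sum_list_map_eq_0) auto
    then show ?thesis using True by simp
  next
    case False
    have swap: "br (br x (a k)) (a y) = scale ((- 1) powi (d k * d y)) (br (br x (a y)) (a k))"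
      using Cons.prems by (intro br_swap) auto
    have "br x (a y) \<in> L (i + d y)" using Cons.prems by (auto intro: br_degree)
    then have "foldl br (br x (a y)) (map a (k # ks))
        = scale ((- 1) powi (\<Sum>q\<leftarrow>ks. if q < k then d k * d q else 0))
          (foldl br (br x (a y)) (map a (insort k ks)))"
      by (rule Cons.IH) (use Cons.prems in auto)
    then show ?thesis
      using False swap by (simp add: foldl_br_scale power_int_add)
  qed
qed

text \<open>Insertion sort by neighbour swaps: the head passes exactly the smaller later entries
  (\<open>foldl_br_insort\<close>), which is the recursion of \<open>inv_exp\<close>.\<close>

lemma foldl_br_sort:
  assumes "x \<in> L i" "\<And>q. q \<in> set ks \<Longrightarrow> a q \<in> A \<inter> L (d q)"
  shows "foldl br x (map a ks) = scale ((- 1) powi inv_exp d ks) (foldl br x (map a (sort ks)))"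
  using assms
proof (induction ks arbitrary: x i)
  case Nil
  then show ?case by simp
next
  case (Cons k ks)
  have "br x (a k) \<in> L (i + d k)" using Cons.prems by (auto intro: br_degree)
  then have "foldl br x (map a (k # ks))
      = scale ((- 1) powi inv_exp d ks) (foldl br x (map a (k # sort ks)))"
    using Cons.IH[of "br x (a k)"] Cons.prems by simp
  also have "foldl br x (map a (k # sort ks)) =
      scale ((- 1) powi (\<Sum>q\<leftarrow>sort ks. if q < k then d k * d q else 0))
        (foldl br x (map a (sort (k # ks))))"
    using Cons.prems foldl_br_insort[of x i "sort ks" k a d] by simp
  also have "(\<Sum>q\<leftarrow>sort ks. if q < k then d k * d q else 0)
      = (\<Sum>q\<leftarrow>ks. if q < k then d k * d q else 0)"
    by (subst (1 2) sum_mset_sum_list[symmetric]) simp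
  finally show ?case by (simp add: power_int_add mult.commute)
qed

text \<open>Permuting the entries permutes the index list, and sorting it back to
  \<open>[0..<length vs]\<close> costs the Koszul sign.\<close>

lemma derived_brackets_permute:
  assumes vs: "list_all2 (\<lambda>d v. v \<in> sub_family A L d) ds vs" and \<sigma>: "\<sigma> permutes {..<length vs}"
  shows "derived_brackets br P \<Delta> (permute_list \<sigma> vs)
    = scale (koszul_sign ds \<sigma>) (derived_brackets br P \<Delta> vs)"
proof -
  have len: "length ds = length vs" using vs by (rule list_all2_lengthD)
  have ks: "set (map \<sigma> [0..<length vs]) = {..<length vs}"
    using permutes_image[OF \<sigma>] by (simp add: atLeast0LessThan)
  moreover have "distinct (map \<sigma> [0..<length vs])"
    using permutes_inj[OF \<sigma>] by (simp add: distinct_map inj_on_def inj_def)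
  ultimately have "sort (map \<sigma> [0..<length vs]) = [0..<length vs]"
    by (intro sorted_distinct_set_unique) auto
  moreover have "vs ! q \<in> A \<inter> L (ds ! q)" if "q < length vs" for q
    using vs that len by (auto simp: list_all2_conv_all_nth sub_family_def)
  ultimately have "foldl br \<Delta> (map (nth vs) (map \<sigma> [0..<length vs])) =
      scale ((- 1) powi inv_exp (nth ds) (map \<sigma> [0..<length vs]))
        (foldl br \<Delta> (map (nth vs) [0..<length vs]))"
    using foldl_br_sort[OF Delta_degree, of "map \<sigma> [0..<length vs]" "nth vs" "nth ds"] ks
    by auto
  then show ?thesis
    using koszul_sign_eq_inv_exp[where 'k = 'k, of \<sigma> ds] \<sigma> len
    by (simp add: derived_brackets_def permute_list_conv_map P_scale map_nth del: map_map)
qed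

lemma derived_brackets_jacobi_subsets:
  assumes a: "\<And>k. k < n \<Longrightarrow> a k \<in> A \<inter> L (d k)"
  shows "(\<Sum>S\<in>Pow {..<n}. scale ((- 1) powi shuffle_exp d S ({..<n} - S))
    (derived_brackets br P \<Delta> (derived_brackets br P \<Delta> (map a (sorted_list_of_set S))
      # map a (sorted_list_of_set ({..<n} - S))))) = 0" (is "sum ?J _ = 0")
proof -
  define X where "X S = foldl br \<Delta> (map a (sorted_list_of_set S))" for S
  have X: "X S \<in> L (1 + sum d S)" if "S \<subseteq> {..<n}" for S
    using that a Delta_degree finite_subset[OF that] unfolding X_def
    by (intro foldl_br_sorted_degree) auto
  have PX: "P (X S) \<in> A \<inter> L (1 + sum d S)" if "S \<subseteq> {..<n}" for S
    using X[OF that] P_degree P_range by blast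
  \<comment> \<open>The inner bracket \<open>P (X S)\<close> has degree \<open>1 + sum d S\<close>
    and moves past all entries indexed by the complement of \<open>S\<close>.\<close>
  have J: "?J S = scale ((- 1) powi (shuffle_exp d S ({..<n} - S) + (1 + sum d S) * sum d ({..<n} - S)))
      (P (br (X ({..<n} - S)) (P (X S))))"
    if "S \<subseteq> {..<n}" for S
  proof -
    define T where "T = {..<n} - S"
    have fT: "finite T" by (simp add: T_def)
    have "foldl br (br \<Delta> (P (X S))) (map a (sorted_list_of_set T))
        = scale ((- 1) powi ((1 + sum d S) * (\<Sum>k\<leftarrow>sorted_list_of_set T. d k)))
          (br (foldl br \<Delta> (map a (sorted_list_of_set T))) (P (X S)))"
      using PX[OF that(1)] a fT by (intro foldl_br_move[OF Delta_degree]) (auto simp: T_def)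
    then show ?thesis
      using fT unfolding X_def T_def[symmetric]
      by (simp add: derived_brackets_def P_scale power_int_add sum_list_distinct_conv_sum_set)
  qed
  \<comment> \<open>The left side is a summand of the Leibniz expansion, with \<open>j = 1\<close>
    the degree of \<open>\<Delta>\<close>. By \<open>P_br\<close> it has two parts: antisymmetry
    turns the first into the Jacobi term of \<open>S\<close>, and the second is that of the
    complement. By \<open>shuffle_exp_swap\<close> the exponents agree modulo 2.\<close>
  have split: "scale ((- 1) powi (shuffle_exp d S ({..<n} - S) + 1 * sum d S)) (P (br (X S) (X ({..<n} - S))))
      = ?J S + ?J ({..<n} - S)" if "S \<in> Pow {..<n}" for S
  proof -
    define T where "T = {..<n} - S"
    have ST: "S \<subseteq> {..<n}" "T \<subseteq> {..<n}" "S = {..<n} - T" using that by (auto simp: T_def)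
    have "P (br (X S) (X T)) = P (br (P (X S)) (X T)) + P (br (X S) (P (X T)))"
      by (rule P_br)
    also have "br (P (X S)) (X T) = - scale ((- 1) powi ((1 + sum d S) * (1 + sum d T))) (br (X T) (P (X S)))"
      using X[OF ST(2)] PX[OF ST(1)] by (intro br_antisymmetric) auto
    finally have eq: "P (br (X S) (X T)) = - scale ((- 1) powi ((1 + sum d S) * (1 + sum d T)))
      (P (br (X T) (P (X S)))) + P (br (X S) (P (X T)))"
      by (simp add: P_minus P_scale)
    have J2: "?J ({..<n} - S) = scale ((- 1) powi (shuffle_exp d T S + (1 + sum d T) * sum d S))
        (P (br (X S) (P (X T))))"
      unfolding T_def[symmetric] ST(3)[symmetric] by (rule J[OF ST(2), unfolded ST(3)[symmetric]])
    have "shuffle_exp d S T + shuffle_exp d T S = sum d S * sum d T"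
      by (rule shuffle_exp_swap) (auto simp: T_def ST(1) intro: finite_subset[OF ST(1)])
    then have sh: "shuffle_exp d T S = sum d S * sum d T - shuffle_exp d S T" by simp
    show ?thesis
      unfolding J[OF ST(1)] J2 unfolding T_def[symmetric] eq sh
      by (cases "even (sum d S)"; cases "even (sum d T)"; cases "even (shuffle_exp d S T)")
        (simp_all add: minus_one_powi)
  qed
  have "0 = P (foldl br (br \<Delta> \<Delta>) (map a [0..<n]))" by (simp add: Delta_square)
  also have "\<dots> = (\<Sum>S\<in>Pow {..<n}. scale ((- 1) powi (shuffle_exp d S ({..<n} - S) + 1 * sum d S))
      (P (br (X S) (X ({..<n} - S)))))"
    using a unfolding X_def
    by (subst foldl_br_leibniz[OF Delta_degree Delta_degree, of n a d]) (auto simp: P_sum P_scale)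
  also have "\<dots> = sum ?J (Pow {..<n}) + (\<Sum>S\<in>Pow {..<n}. ?J ({..<n} - S))"
    by (subst sum.distrib[symmetric]) (rule sum.cong[OF refl split])
  also have "(\<Sum>S\<in>Pow {..<n}. ?J ({..<n} - S)) = sum ?J (Pow {..<n})"
    by (rule sum.reindex_bij_witness[where i = "\<lambda>S. {..<n} - S" and j = "\<lambda>S. {..<n} - S"])
      (auto simp: double_diff)
  finally have "sum ?J (Pow {..<n}) + sum ?J (Pow {..<n}) = 0" by (rule sym)
  \<comment> \<open>In characteristic 0 the factor 2 cancels.\<close>
  then have "scale (1 + 1) (sum ?J (Pow {..<n})) = 0"
    by (simp only: scale_left_distrib scale_one)
  then show ?thesis by (simp only: scale_eq_0_iff one_add_one zero_neq_numeral[symmetric] simp_thms)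
qed

lemma derived_brackets_jacobi:
  assumes vs: "list_all2 (\<lambda>d v. v \<in> sub_family A L d) ds vs"
  shows "(\<Sum>i=0..length vs. \<Sum>\<sigma>\<in>unshuffles i (length vs). scale (koszul_sign ds \<sigma>)
    (derived_brackets br P \<Delta> (derived_brackets br P \<Delta> (take i (permute_list \<sigma> vs))
      # drop i (permute_list \<sigma> vs)))) = 0"
proof -
  \<comment> \<open>Each Jacobi summand as a function of the index lists of its two blocks, the
    shape that \<open>sum_unshuffles\<close> expects.\<close>
  define G where "G ks ls = scale ((- 1) powi inv_exp (nth ds) (ks @ ls))
    (derived_brackets br P \<Delta> (derived_brackets br P \<Delta> (map (nth vs) ks) # map (nth vs) ls))"
    for ks ls
  have len: "length ds = length vs" using vs by (rule list_all2_lengthD)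
  have summand: "scale (koszul_sign ds \<sigma>)
      (derived_brackets br P \<Delta> (derived_brackets br P \<Delta> (take i (permute_list \<sigma> vs))
        # drop i (permute_list \<sigma> vs))) = G (map \<sigma> [0..<i]) (map \<sigma> [i..<length vs])"
    if "i \<le> length vs" "\<sigma> \<in> unshuffles i (length vs)" for i \<sigma>
  proof -
    have "[0..<i] @ [i..<length vs] = [0..<length vs]"
      using that(1) by (metis le0 upt_add_eq_append le_add_diff_inverse)
    then have "map \<sigma> [0..<i] @ map \<sigma> [i..<length vs] = map \<sigma> [0..<length ds]"
      by (metis len map_append)
    moreover have "\<sigma> permutes {..<length ds}" using that len by (simp add: unshuffles_def)
    ultimately show ?thesis
      using that(1) unfolding G_def
      by (simp add: koszul_sign_eq_inv_exp permute_list_def take_map drop_map comp_def)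
  qed
  have "(\<Sum>i=0..length vs. \<Sum>\<sigma>\<in>unshuffles i (length vs). scale (koszul_sign ds \<sigma>)
      (derived_brackets br P \<Delta> (derived_brackets br P \<Delta> (take i (permute_list \<sigma> vs))
        # drop i (permute_list \<sigma> vs))))
    = (\<Sum>i=0..length vs. \<Sum>\<sigma>\<in>unshuffles i (length vs). G (map \<sigma> [0..<i]) (map \<sigma> [i..<length vs]))"
    using summand by (intro sum.cong) auto
  also have "\<dots> = (\<Sum>S\<in>Pow {..<length vs}.
      G (sorted_list_of_set S) (sorted_list_of_set ({..<length vs} - S)))"
    by (rule sum_unshuffles)
  also have "\<dots> = (\<Sum>S\<in>Pow {..<length vs}.
      scale ((- 1) powi shuffle_exp (nth ds) S ({..<length vs} - S))
    (derived_brackets br P \<Delta> (derived_brackets br P \<Delta> (map (nth vs) (sorted_list_of_set S))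
      # map (nth vs) (sorted_list_of_set ({..<length vs} - S)))))"
    by (rule sum.cong) (auto simp: G_def inv_exp_append finite_subset)
  also have "\<dots> = 0"
    using vs len
    by (intro derived_brackets_jacobi_subsets) (auto simp: list_all2_conv_all_nth sub_family_def)
  finally show ?thesis .
qed

lemma curved_Linfty1_algebra_derived_brackets:
  "curved_Linfty1_algebra scale (sub_family A L) (derived_brackets br P \<Delta>)"
proof -
  interpret AL: graded_vector_space scale "sub_family A L"
  proof
    show "subspace (sub_family A L i)" for i
      unfolding sub_family_def by (intro subspace_inter subspace_A subspace_component)
  qed (auto simp: sub_family_def intro: independent_components)
  show ?thesis
  proof
    fix us vs x y
    show "derived_brackets br P \<Delta> (us @ (x + y) # vs)
      = derived_brackets br P \<Delta> (us @ x # vs) + derived_brackets br P \<Delta> (us @ y # vs)"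
      by (simp add: derived_brackets_def br_add_right foldl_br_add P_add)
  next
    fix us vs x c
    show "derived_brackets br P \<Delta> (us @ scale c x # vs)
      = scale c (derived_brackets br P \<Delta> (us @ x # vs))"
      by (simp add: derived_brackets_def br_scale_right foldl_br_scale P_scale)
  next
    fix ds vs
    assume "list_all2 (\<lambda>d v. v \<in> sub_family A L d) ds vs"
    then have "list_all2 (\<lambda>d v. v \<in> L d) ds vs"
      by (rule list_all2_mono) (simp add: sub_family_def)
    then have "foldl br \<Delta> vs \<in> L (sum_list ds + 1)"
      using foldl_br_degree[OF _ Delta_degree] by (metis add.commute)
    then show "derived_brackets br P \<Delta> vs \<in> sub_family A L (sum_list ds + 1)"
      by (simp add: derived_brackets_def sub_family_def P_degree P_range)
  qed (fact derived_brackets_permute derived_brackets_jacobi)+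
qed

end

section \<open>Homogeneous components\<close>

context graded_vector_space
begin

text \<open>Independence of the components, applied to \<open>f - g\<close>. It makes the
  description in \<open>hom_comp\<close> unique.\<close>

lemma decomposition_unique:
  assumes f: "\<And>i. f i \<in> V i" "finite {i. f i \<noteq> 0}" and g: "\<And>i. g i \<in> V i" "finite {i. g i \<noteq> 0}"
    and eq: "(\<Sum>i | f i \<noteq> 0. f i) = (\<Sum>i | g i \<noteq> 0. g i)"
  shows "f = g"
proof
  fix i
  \<comment> \<open>A common index set for both sums; inserting \<open>i\<close> covers an index
    outside both supports.\<close>
  define I where "I = insert i ({i. f i \<noteq> 0} \<union> {i. g i \<noteq> 0})"
  have fin: "finite I" using f g by (simp add: I_def)
  have "(\<Sum>i | f i \<noteq> 0. f i) = sum f I" "(\<Sum>i | g i \<noteq> 0. g i) = sum g I"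
    using fin by (auto simp: I_def intro!: sum.mono_neutral_left)
  then have "(\<Sum>i\<in>I. f i - g i) = 0" using eq by (simp add: sum_subtractf)
  then have "f i - g i = 0"
    using fin f g by (intro independent_components[of I "\<lambda>i. f i - g i"] subspace_diff subspace_component)
      (auto simp: I_def)
  then show "f i = g i" by simp
qed

lemma hom_comp_eqI:
  assumes "\<And>i. f i \<in> V i" "finite {i. f i \<noteq> 0}" "v = (\<Sum>i | f i \<noteq> 0. f i)"
  shows "hom_comp V d v = f d"
proof -
  have "(THE g. (\<forall>i. g i \<in> V i) \<and> finite {i. g i \<noteq> 0} \<and> v = (\<Sum>i | g i \<noteq> 0. g i)) = f"
  proof (rule the_equality)
    show "(\<forall>i. f i \<in> V i) \<and> finite {i. f i \<noteq> 0} \<and> v = (\<Sum>i | f i \<noteq> 0. f i)"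
      using assms by blast
  next
    fix g
    assume g: "(\<forall>i. g i \<in> V i) \<and> finite {i. g i \<noteq> 0} \<and> v = (\<Sum>i | g i \<noteq> 0. g i)"
    then have "(\<Sum>i | g i \<noteq> 0. g i) = (\<Sum>i | f i \<noteq> 0. f i)" using assms(3) by simp
    then show "g = f" using g assms(1,2) by (intro decomposition_unique) blast+
  qed
  then show ?thesis by (simp add: hom_comp_def)
qed

lemma hom_comp_homogeneous:
  assumes "v \<in> V e"
  shows "hom_comp V d v = (if d = e then v else 0)"
proof -
  have "{i. (if i = e then v else 0) \<noteq> 0} = (if v = 0 then {} else {e})" by auto
  then show ?thesis
    using assms subspace_0[OF subspace_component]
    by (intro hom_comp_eqI) auto
qed

text \<open>The finite sums of homogeneous elements form a subspace containing every component,
  hence the span.\<close>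

lemma decomposition_exists:
  assumes "v \<in> total"
  shows "\<exists>f. (\<forall>i. f i \<in> V i) \<and> finite {i. f i \<noteq> 0} \<and> v = (\<Sum>i | f i \<noteq> 0. f i)"
proof -
  let ?S = "{v. \<exists>f I. (\<forall>i. f i \<in> V i) \<and> finite I \<and> v = sum f I}"
  have "subspace ?S"
  proof (rule subspaceI)
    show "0 \<in> ?S"
      using subspace_0[OF subspace_component]
      by (auto intro!: exI[of _ "\<lambda>_. 0"] exI[of _ "{}"])
  next
    fix x y
    assume "x \<in> ?S" "y \<in> ?S"
    then obtain f I g J where f: "\<forall>i. f i \<in> V i" "finite I" "x = sum f I"
      and g: "\<forall>i. g i \<in> V i" "finite J" "y = sum g J" by blast
    \<comment> \<open>\<open>f\<close> and \<open>g\<close> are arbitrary outside \<open>I\<close>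
      and \<open>J\<close>, so they are cut off before being summed over the union.\<close>
    let ?h = "\<lambda>i. (if i \<in> I then f i else 0) + (if i \<in> J then g i else 0)"
    have "x + y = sum ?h (I \<union> J)"
      using f g by (simp add: sum.distrib sum.inter_restrict[symmetric] Int_absorb1)
    moreover have "\<forall>i. ?h i \<in> V i"
      using f g by (auto intro!: subspace_add[OF subspace_component] subspace_0[OF subspace_component])
    ultimately show "x + y \<in> ?S" 
      using finite_UnI[OF f(2) g(2)] by (intro CollectI exI[of _ ?h] exI[of _ "I \<union> J"] conjI)
  next
    fix c x
    assume "x \<in> ?S"
    then obtain f I where f: "\<forall>i. f i \<in> V i" "finite I" "x = sum f I" by blast
    then have "scale c x = (\<Sum>i\<in>I. scale c (f i))" "\<forall>i. scale c (f i) \<in> V i"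
      by (auto simp: scale_sum_right intro: subspace_scale[OF subspace_component])
    then show "scale c x \<in> ?S"
      using f(2) by (intro CollectI exI[of _ "\<lambda>i. scale c (f i)"] exI[of _ I] conjI)
  qed
  moreover have "(\<Union>i. V i) \<subseteq> ?S"
  proof
    fix v assume "v \<in> (\<Union>i. V i)"
    then obtain d where "v \<in> V d" by blast
    let ?f = "\<lambda>i. if i = d then v else 0"
    have "\<forall>i. ?f i \<in> V i" "finite {d}" "v = sum ?f {d}"
      using \<open>v \<in> V d\<close> subspace_0[OF subspace_component] by auto
    then show "v \<in> ?S" by (intro CollectI exI[of _ ?f] exI[of _ "{d}"] conjI)
  qed
  ultimately have "v \<in> ?S" using assms span_minimal unfolding total_def by blast
  then obtain f I where f: "\<forall>i. f i \<in> V i" "finite I" "v = sum f I" by blast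
  \<comment> \<open>Cutting \<open>f\<close> off outside \<open>I\<close> makes its support
    finite.\<close>
  let ?g = "\<lambda>i. if i \<in> I then f i else 0"
  have supp: "{i. ?g i \<noteq> 0} \<subseteq> I" by auto
  have "\<forall>i. ?g i \<in> V i" using f(1) subspace_0[OF subspace_component] by auto
  moreover have "finite {i. ?g i \<noteq> 0}" using supp f(2) by (rule finite_subset)
  moreover have "v = (\<Sum>i | ?g i \<noteq> 0. ?g i)"
    using f by (auto intro!: sum.mono_neutral_cong_right)
  ultimately show ?thesis by (intro exI[of _ ?g] conjI)
qed

text \<open>A nonzero homogeneous \<open>w\<close> admits only the degree list
  \<open>replicate n e\<close>. If \<open>w = 0\<close> and \<open>n > 0\<close> there is no degree
  list and the sum is empty, which \<open>zero\<close> reconciles with the formula.\<close>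

lemma graded_ext_replicate:
  assumes w: "w \<in> V e" and zero: "w = 0 \<Longrightarrow> f (replicate n e) (replicate n w) = 0"
  shows "graded_ext V f (replicate n w) = f (replicate n e) (replicate n w)"
proof (cases "w = 0 \<and> n > 0")
  case True
  then have "{ds. list_all2 (\<lambda>d v. hom_comp V d v \<noteq> 0) ds (replicate n w)} = {}"
    using w by (auto simp: list_all2_conv_all_nth hom_comp_homogeneous)
  then show ?thesis using True zero by (simp add: graded_ext_def)
next
  case False
  have "{ds. list_all2 (\<lambda>d v. hom_comp V d v \<noteq> 0) ds (replicate n w)} = {replicate n e}"
    using False w
    by (auto simp: list_all2_conv_all_nth hom_comp_homogeneous intro!: nth_equalityI split: if_splits)
  moreover have "hom_comp V e w = w" using w by (simp add: hom_comp_homogeneous)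
  ultimately show ?thesis by (simp add: graded_ext_def zip_replicate)
qed

end

section \<open>Convergence in a complete filtration\<close>

context complete_filtration
begin

lemma subspace_filtration: "subspace (F k)"
  using graded_subspace_filtration by (simp add: graded_subspace_def)

text \<open>Separation is assumed degreewise; it extends to all of \<open>F (- 1) = total\<close>
  because each \<open>F n\<close> is graded and so contains the components of its elements.\<close>

lemma filtration_separated_total:
  assumes "\<And>n. v \<in> F n"
  shows "v = 0"
proof -
  have "v \<in> total" using assms[of "- 1"] filtration_total by auto
  then obtain f where f: "\<forall>i. f i \<in> V i" "finite {i. f i \<noteq> 0}" "v = (\<Sum>i | f i \<noteq> 0. f i)"
    using decomposition_exists by blast
  have "f i = 0" for i
  proof (rule filtration_separated)
    show "f i \<in> V i" using f by blast
    have "hom_comp V i v = f i" using f by (intro hom_comp_eqI) auto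
    then show "f i \<in> F n" for n
      using assms graded_subspace_filtration[of n] by (metis graded_subspace_def)
  qed
  then show ?thesis using f by simp
qed

lemma filt_sums_unique:
  assumes "filt_sums F f l" "filt_sums F f l'"
  shows "l = l'"
proof -
  have "l - l' \<in> F k" for k
  proof -
    have "\<forall>\<^sub>F N in sequentially. (\<Sum>n<N. f n) - l \<in> F k \<and> (\<Sum>n<N. f n) - l' \<in> F k"
      using assms by (simp add: filt_sums_def eventually_conj)
    then obtain N where "(\<Sum>n<N. f n) - l \<in> F k" "(\<Sum>n<N. f n) - l' \<in> F k"
      by (auto simp: eventually_sequentially)
    then have "((\<Sum>n<N. f n) - l') - ((\<Sum>n<N. f n) - l) \<in> F k"
      by (rule subspace_diff[OF subspace_filtration, rotated])
    then show ?thesis by simp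
  qed
  then have "l - l' = 0" by (rule filtration_separated_total)
  then show ?thesis by simp
qed

lemma filt_suminf_eq: "filt_sums F f l \<Longrightarrow> filt_suminf F f = l"
  unfolding filt_suminf_def using filt_sums_unique by blast

lemma filt_sums_iff:
  "filt_sums F f l \<Longrightarrow> filt_sums F f l' \<longleftrightarrow> l = l'"
  using filt_sums_unique by blast

lemma filt_sums_add:
  assumes "filt_sums F f l" "filt_sums F g l'"
  shows "filt_sums F (\<lambda>n. f n + g n) (l + l')"
  unfolding filt_sums_def
proof
  fix k
  have "\<forall>\<^sub>F N in sequentially. (\<Sum>n<N. f n) - l \<in> F k \<and> (\<Sum>n<N. g n) - l' \<in> F k"
    using assms by (simp add: filt_sums_def eventually_conj)
  then show "\<forall>\<^sub>F N in sequentially. (\<Sum>n<N. f n + g n) - (l + l') \<in> F k"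
  proof (rule eventually_mono)
    fix N assume "(\<Sum>n<N. f n) - l \<in> F k \<and> (\<Sum>n<N. g n) - l' \<in> F k"
    then have "((\<Sum>n<N. f n) - l) + ((\<Sum>n<N. g n) - l') \<in> F k"
      by (intro subspace_add subspace_filtration) auto
    then show "(\<Sum>n<N. f n + g n) - (l + l') \<in> F k"
      by (simp add: sum.distrib algebra_simps)
  qed
qed

lemma filt_sums_scale:
  assumes "filt_sums F f l"
  shows "filt_sums F (\<lambda>n. scale c (f n)) (scale c l)"
  unfolding filt_sums_def
proof
  fix k
  show "\<forall>\<^sub>F N in sequentially. (\<Sum>n<N. scale c (f n)) - scale c l \<in> F k"
    using assms[unfolded filt_sums_def, rule_format, of k]
    by (rule eventually_mono)
      (simp add: scale_sum_right[symmetric] scale_right_diff_distrib[symmetric]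
        subspace_scale[OF subspace_filtration])
qed

lemma filt_sums_Suc_iff: "filt_sums F (\<lambda>n. f (Suc n)) l \<longleftrightarrow> filt_sums F f (f 0 + l)"
proof -
  have "(\<forall>\<^sub>F N in sequentially. (\<Sum>n<N. f n) - (f 0 + l) \<in> F k)
    \<longleftrightarrow> (\<forall>\<^sub>F N in sequentially. (\<Sum>n<Suc N. f n) - (f 0 + l) \<in> F k)" for k
    by (rule eventually_sequentially_Suc[symmetric])
  then show ?thesis
    by (simp add: filt_sums_def sum.lessThan_Suc_shift del: sum.lessThan_Suc)
qed

lemma filt_sums_finite:
  assumes "\<And>n. n \<ge> M \<Longrightarrow> f n = 0"
  shows "filt_sums F f (\<Sum>n<M. f n)"
  unfolding filt_sums_def
proof
  fix k
  show "\<forall>\<^sub>F N in sequentially. (\<Sum>n<N. f n) - (\<Sum>n<M. f n) \<in> F k"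
    using eventually_ge_at_top[of M]
  proof (rule eventually_mono)
    fix N assume "M \<le> N"
    then have "(\<Sum>n<N. f n) = (\<Sum>n<M. f n)"
      using assms by (intro sum.mono_neutral_right) auto
    then show "(\<Sum>n<N. f n) - (\<Sum>n<M. f n) \<in> F k"
      using subspace_0[OF subspace_filtration] by simp
  qed
qed

end

lemma foldl_replicate_Suc: "foldl f x (replicate (Suc n) a) = f (foldl f x (replicate n a)) a"
  by (subst replicate_Suc, subst replicate_append_same[symmetric]) simp

text \<open>Both sides sum \<open>f i n\<close> over \<open>i + n < N\<close>, by rows and by
  diagonals.\<close>

lemma sum_triangle:
  fixes f :: "nat \<Rightarrow> nat \<Rightarrow> 'a::comm_monoid_add"
  shows "(\<Sum>n<N. \<Sum>i<N - n. f i n) = (\<Sum>m<N. \<Sum>i\<le>m. f i (m - i))"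
proof -
  have "(\<Sum>n<N. \<Sum>i<N - n. f i n) = (\<Sum>(n, i)\<in>(SIGMA n:{..<N}. {..<N - n}). f i n)"
    by (rule sum.Sigma) auto
  also have "\<dots> = (\<Sum>(i, n)\<in>{(i, n). i + n < N}. f i n)"
    by (rule sum.reindex_bij_witness[where i = prod.swap and j = prod.swap]) auto
  finally show ?thesis by (simp add: sum.triangle_reindex)
qed

section \<open>The exponential automorphisms and Maurer-Cartan elements\<close>

context filtered_V_data
begin

definition exp_term :: "'v \<Rightarrow> nat \<Rightarrow> 'v \<Rightarrow> 'v" where
  "exp_term a n x = scale (inverse (fact n)) (foldl br x (replicate n a))"

lemma exp_term_0 [simp]: "exp_term a 0 x = x"
  by (simp add: exp_term_def)

lemma br_exp_term: "br (exp_term a n x) a = scale (of_nat (Suc n)) (exp_term a (Suc n) x)"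
proof -
  have "of_nat (Suc n) * inverse (fact (Suc n)) = (inverse (fact n) :: 'k)"
    by (simp add: divide_simps del: of_nat_Suc)
  then show ?thesis
    by (simp add: exp_term_def br_scale_left foldl_replicate_Suc del: replicate_Suc of_nat_Suc fact_Suc)
qed

lemma exp_term_Suc: "exp_term a (Suc n) x = scale (inverse (of_nat (Suc n))) (br (exp_term a n x) a)"
  by (simp add: br_exp_term del: of_nat_Suc)

lemma exp_term_degree: "a \<in> L 0 \<Longrightarrow> x \<in> L d \<Longrightarrow> exp_term a n x \<in> L d"
proof (induction n)
  case (Suc n)
  then have "br (exp_term a n x) a \<in> L (d + 0)" by (intro br_degree) auto
  then show ?case by (simp add: exp_term_Suc subspace_scale[OF subspace_component] del: of_nat_Suc)
qed simp

text \<open>Each bracket with \<open>a\<close> raises the filtration index by one; this is why the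
  exponential series converges.\<close>

lemma exp_term_filtration: "a \<in> F 1 \<Longrightarrow> x \<in> F k \<Longrightarrow> exp_term a n x \<in> F (k + int n)"
proof (induction n)
  case (Suc n)
  then have "br (exp_term a n x) a \<in> F (k + int n + 1)" by (intro br_filtration) auto
  then have "br (exp_term a n x) a \<in> F (k + int (Suc n))" by (simp add: add_ac)
  then show ?case by (simp only: exp_term_Suc subspace_scale[OF subspace_filtration])
qed simp

lemma exp_term_add: "exp_term a n (x + y) = exp_term a n x + exp_term a n y"
  by (simp add: exp_term_def foldl_br_add scale_right_distrib)

lemma exp_term_scale: "exp_term a n (scale c x) = scale c (exp_term a n x)"
  by (simp add: exp_term_def foldl_br_scale mult.commute)

text \<open>\<open>a\<close> and \<open>b\<close> commute and have degree 0, so \<open>b\<close>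
  moves past every \<open>a\<close> without a sign.\<close>

lemma exp_term_br_commute:
  assumes "a \<in> A \<inter> L 0" "b \<in> A \<inter> L 0" "x \<in> L d"
  shows "exp_term a n (br x b) = br (exp_term a n x) b"
proof (induction n)
  case (Suc n)
  have "br (br (exp_term a n x) b) a = scale ((- 1) powi (0 * 0)) (br (br (exp_term a n x) a) b)"
    using assms by (intro br_swap exp_term_degree) auto
  then show ?case using Suc by (simp add: exp_term_Suc br_scale_left del: of_nat_Suc)
qed simp

text \<open>The binomial theorem for the commuting operators \<open>[\<cdot>, a]\<close> and
  \<open>[\<cdot>, b]\<close>, with the factorials absorbed into \<open>exp_term\<close>.\<close>

lemma exp_term_binomial:
  assumes a: "a \<in> A \<inter> L 0" and b: "b \<in> A \<inter> L 0" and x: "x \<in> L d"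
  shows "exp_term (a + b) m x = (\<Sum>i\<le>m. exp_term a i (exp_term b (m - i) x))"
proof (induction m)
  case (Suc m)
  define u where "u i j = exp_term a i (exp_term b j x)" for i j
  have bx: "exp_term b j x \<in> L d" for j using b x by (intro exp_term_degree) auto
  have ua: "br (u i j) a = scale (of_nat (Suc i)) (u (Suc i) j)" for i j
    by (simp only: u_def br_exp_term)
  have ub: "br (u i j) b = scale (of_nat (Suc j)) (u i (Suc j))" for i j
    unfolding u_def exp_term_br_commute[OF a b bx, symmetric] br_exp_term exp_term_scale ..
  \<comment> \<open>After multiplication by \<open>m + 1\<close>, bracketing with \<open>a\<close>
    contributes the coefficient \<open>i\<close> and bracketing with \<open>b\<close> the
    coefficient \<open>m + 1 - i\<close>; together they give \<open>m + 1\<close> again.\<close>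
  have "scale (of_nat (Suc m)) (exp_term (a + b) (Suc m) x) = br (exp_term (a + b) m x) (a + b)"
    by (rule br_exp_term[symmetric])
  also have "\<dots> = (\<Sum>i\<le>m. br (u i (m - i)) a) + (\<Sum>i\<le>m. br (u i (m - i)) b)"
    unfolding Suc.IH br_sum_left u_def[symmetric] by (simp add: br_add_right sum.distrib)
  also have "(\<Sum>i\<le>m. br (u i (m - i)) a) = (\<Sum>i\<le>Suc m. scale (of_nat i) (u i (Suc m - i)))"
    unfolding ua by (simp add: sum.atMost_Suc_shift del: sum.atMost_Suc of_nat_Suc)
  also have "(\<Sum>i\<le>m. br (u i (m - i)) b) = (\<Sum>i\<le>Suc m. scale (of_nat (Suc m - i)) (u i (Suc m - i)))"
    unfolding ub by (simp add: Suc_diff_le del: of_nat_Suc of_nat_diff)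
  also have "(\<Sum>i\<le>Suc m. scale (of_nat i) (u i (Suc m - i)))
      + (\<Sum>i\<le>Suc m. scale (of_nat (Suc m - i)) (u i (Suc m - i)))
    = (\<Sum>i\<le>Suc m. scale (of_nat (Suc m)) (u i (Suc m - i)))"
    unfolding sum.distrib[symmetric] scale_left_distrib[symmetric] of_nat_add[symmetric]
    by (intro sum.cong) auto
  finally show ?case
    by (simp add: scale_sum_right[symmetric] u_def del: of_nat_Suc sum.atMost_Suc)
qed simp

lemma exp_br_converges:
  assumes a: "a \<in> A \<inter> L 0" and x: "x \<in> L d"
  shows "exp_br scale br F a x \<in> L d" and "filt_sums F (\<lambda>n. exp_term a n x) (exp_br scale br F a x)"
proof -
  have a1: "a \<in> F 1" using a A0_filtration by blast
  have x1: "x \<in> F (- 1)" using filtration_total total_UNIV by simp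
  \<comment> \<open>Since \<open>x\<close> is only known to lie in \<open>F (- 1)\<close>, the term
    of index \<open>n\<close> lies in \<open>F (n - 1)\<close>. Taking \<open>k + 1\<close> terms
    puts \<open>s (k + 1) - s k\<close> into \<open>F k\<close>; for negative \<open>k\<close> the
    sum is empty.\<close>
  define s where "s k = (\<Sum>n<nat (k + 1). exp_term a n x)" for k :: int
  have sd: "s k \<in> L d" for k
    unfolding s_def using a x by (intro subspace_sum[OF subspace_component] exp_term_degree) auto
  have "s (k + 1) - s k \<in> F k" for k
  proof (cases "k \<ge> - 1")
    case True
    then have "nat (k + 1 + 1) = Suc (nat (k + 1))" by simp
    then have "s (k + 1) - s k = exp_term a (nat (k + 1)) x" by (simp add: s_def)
    also have "\<dots> \<in> F (- 1 + int (nat (k + 1)))" by (rule exp_term_filtration[OF a1 x1])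
    finally show ?thesis using True by simp
  next
    case False
    then show ?thesis using filtration_total[of k] total_UNIV by simp
  qed
  then obtain v where v: "v \<in> L d" "\<And>k. v - s k \<in> F k"
    using filtration_complete[of s d] sd by blast
  have "filt_sums F (\<lambda>n. exp_term a n x) v"
    unfolding filt_sums_def
  proof
    fix k
    show "\<forall>\<^sub>F N in sequentially. (\<Sum>n<N. exp_term a n x) - v \<in> F k"
      using eventually_ge_at_top[of "nat (k + 1)"]
    proof (rule eventually_mono)
      fix N assume "nat (k + 1) \<le> N"
      then have "k \<le> int N - 1" by simp
      then have "v - s (int N - 1) \<in> F k" using v(2) filtration_descending by blast
      then have "- (v - s (int N - 1)) \<in> F k" by (rule subspace_neg[OF subspace_filtration])
      then show "(\<Sum>n<N. exp_term a n x) - v \<in> F k" by (simp add: s_def)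
    qed
  qed
  moreover from this have "exp_br scale br F a x = v"
    unfolding exp_br_def exp_term_def[symmetric] by (rule filt_suminf_eq)
  ultimately show "exp_br scale br F a x \<in> L d" "filt_sums F (\<lambda>n. exp_term a n x) (exp_br scale br F a x)"
    using v(1) by simp_all
qed

lemma exp_br_add:
  assumes "a \<in> A \<inter> L 0" "x \<in> L d" "y \<in> L d"
  shows "exp_br scale br F a (x + y) = exp_br scale br F a x + exp_br scale br F a y"
proof (rule filt_sums_unique)
  show "filt_sums F (\<lambda>n. exp_term a n (x + y)) (exp_br scale br F a (x + y))"
    using assms by (intro exp_br_converges(2) subspace_add[OF subspace_component])
  show "filt_sums F (\<lambda>n. exp_term a n (x + y)) (exp_br scale br F a x + exp_br scale br F a y)"
    unfolding exp_term_add using assms by (intro filt_sums_add exp_br_converges(2))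
qed

lemma exp_br_scale:
  assumes "a \<in> A \<inter> L 0" "x \<in> L d"
  shows "exp_br scale br F a (scale c x) = scale c (exp_br scale br F a x)"
proof (rule filt_sums_unique)
  show "filt_sums F (\<lambda>n. exp_term a n (scale c x)) (exp_br scale br F a (scale c x))"
    using assms by (intro exp_br_converges(2) subspace_scale[OF subspace_component])
  show "filt_sums F (\<lambda>n. exp_term a n (scale c x)) (scale c (exp_br scale br F a x))"
    unfolding exp_term_scale using assms by (intro filt_sums_scale exp_br_converges(2))
qed

text \<open>Tail estimate: all terms from index \<open>M\<close> on lie in \<open>F (k + M)\<close>,
  and a sufficiently long partial sum agrees with the exponential modulo that subspace.\<close>

lemma exp_br_approx:
  assumes a: "a \<in> A \<inter> L 0" and x: "x \<in> L d" "x \<in> F k"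
  shows "exp_br scale br F a x - (\<Sum>n<M. exp_term a n x) \<in> F (k + int M)"
proof -
  have a1: "a \<in> F 1" using a A0_filtration by blast
  have "\<forall>\<^sub>F N in sequentially. (\<Sum>n<N. exp_term a n x) - exp_br scale br F a x \<in> F (k + int M) \<and> M \<le> N"
    using exp_br_converges(2)[OF a x(1)] eventually_ge_at_top
    by (auto simp: filt_sums_def intro: eventually_conj)
  then obtain N where N: "(\<Sum>n<N. exp_term a n x) - exp_br scale br F a x \<in> F (k + int M)" "M \<le> N"
    by (auto simp: eventually_sequentially)
  have "(\<Sum>n<N. exp_term a n x) - (\<Sum>n<M. exp_term a n x) = (\<Sum>n=M..<N. exp_term a n x)"
    using N(2) by (simp add: lessThan_atLeast0 sum_diff_nat_ivl)
  moreover have "(\<Sum>n=M..<N. exp_term a n x) \<in> F (k + int M)"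
  proof (rule subspace_sum[OF subspace_filtration])
    fix n assume "n \<in> {M..<N}"
    then have "F (k + int n) \<subseteq> F (k + int M)" by (intro filtration_descending) auto
    then show "exp_term a n x \<in> F (k + int M)" using exp_term_filtration[OF a1 x(2)] by blast
  qed
  ultimately have "((\<Sum>n<N. exp_term a n x) - (\<Sum>n<M. exp_term a n x))
      - ((\<Sum>n<N. exp_term a n x) - exp_br scale br F a x) \<in> F (k + int M)"
    using N(1) by (simp only: subspace_diff[OF subspace_filtration])
  then show ?thesis by simp
qed

text \<open>The law \<open>e^a e^b = e^(a+b)\<close> with the outer exponential applied term by
  term, as it is in the Maurer-Cartan series for \<open>P \<circ> e^a\<close>.\<close>

lemma exp_br_exp_term_sums:
  assumes a: "a \<in> A \<inter> L 0" and b: "b \<in> A \<inter> L 0" and x: "x \<in> L d"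
  shows "filt_sums F (\<lambda>n. exp_br scale br F a (exp_term b n x)) (exp_br scale br F (a + b) x)"
  unfolding filt_sums_def
proof
  fix k
  let ?E = "exp_br scale br F"
  have b1: "b \<in> F 1" using b A0_filtration by blast
  have x1: "x \<in> F (- 1)" using filtration_total total_UNIV by simp
  have ab: "a + b \<in> A \<inter> L 0"
    using a b subspace_add[OF subspace_A] subspace_add[OF subspace_component] by blast
  show "\<forall>\<^sub>F N in sequentially. (\<Sum>n<N. ?E a (exp_term b n x)) - ?E (a + b) x \<in> F k"
    using eventually_ge_at_top[of "nat (k + 1)"]
  proof (rule eventually_mono)
    fix N assume "nat (k + 1) \<le> N"
    then have sub: "F (- 1 + int N) \<subseteq> F k" by (intro filtration_descending) auto
    \<comment> \<open>Keeping \<open>N - n\<close> terms of the outer series makes the error lie in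
      \<open>F (N - 1)\<close> for every \<open>n\<close>. The remaining triangular sum is the
      partial sum for \<open>a + b\<close>, by the binomial formula.\<close>
    have "?E a (exp_term b n x) - (\<Sum>i<N - n. exp_term a i (exp_term b n x)) \<in> F (- 1 + int N)"
      if "n < N" for n
    proof -
      have "?E a (exp_term b n x) - (\<Sum>i<N - n. exp_term a i (exp_term b n x))
          \<in> F ((- 1 + int n) + int (N - n))"
        using b x by (intro exp_br_approx[OF a] exp_term_degree exp_term_filtration[OF b1 x1]) auto
      then show ?thesis using that by (simp add: of_nat_diff)
    qed
    then have "(\<Sum>n<N. ?E a (exp_term b n x) - (\<Sum>i<N - n. exp_term a i (exp_term b n x))) \<in> F (- 1 + int N)"
      by (intro subspace_sum[OF subspace_filtration]) auto
    then have "(\<Sum>n<N. ?E a (exp_term b n x)) - (\<Sum>m<N. exp_term (a + b) m x) \<in> F (- 1 + int N)"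
      by (simp add: sum_subtractf sum_triangle exp_term_binomial[OF a b x])
    moreover have "?E (a + b) x - (\<Sum>m<N. exp_term (a + b) m x) \<in> F (- 1 + int N)"
      by (rule exp_br_approx[OF ab x x1])
    ultimately have "((\<Sum>n<N. ?E a (exp_term b n x)) - (\<Sum>m<N. exp_term (a + b) m x))
        - (?E (a + b) x - (\<Sum>m<N. exp_term (a + b) m x)) \<in> F k"
      using sub subspace_diff[OF subspace_filtration] by blast
    then show "(\<Sum>n<N. ?E a (exp_term b n x)) - ?E (a + b) x \<in> F k" by simp
  qed
qed

section \<open>Maurer-Cartan elements of the derived brackets\<close>

lemma filt_sums_P:
  assumes "filt_sums F f l"
  shows "filt_sums F (\<lambda>n. P (f n)) (P l)"
  unfolding filt_sums_def
proof
  fix k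
  show "\<forall>\<^sub>F N in sequentially. (\<Sum>n<N. P (f n)) - P l \<in> F k"
    using assms[unfolded filt_sums_def, rule_format, of k]
    by (rule eventually_mono) (use P_filtration in \<open>auto simp: P_sum[symmetric] P_diff[symmetric]\<close>)
qed

lemma filt_sums_sub_family_iff:
  assumes "\<And>n. f n \<in> A" "l \<in> A"
  shows "filt_sums (sub_family A F) f l \<longleftrightarrow> filt_sums F f l"
proof -
  have "(\<Sum>n<N. f n) - l \<in> A" for N
    using assms by (intro subspace_diff[OF subspace_A] subspace_sum[OF subspace_A]) auto
  then show ?thesis by (simp add: filt_sums_def sub_family_def)
qed

text \<open>The Maurer-Cartan series is \<open>P\<close> applied termwise to the exponential series,
  and \<open>P\<close>, preserving the filtration, commutes with convergent sums.\<close>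

lemma MC_derived_iff:
  assumes a: "a \<in> A \<inter> L 0" and x: "x \<in> L d"
  shows "a \<in> MC_derived scale L br A F P x \<longleftrightarrow> P (exp_br scale br F a x) = 0"
proof -
  have "filt_sums (sub_family A F) (\<lambda>n. P (exp_term a n x)) 0 \<longleftrightarrow> P (exp_br scale br F a x) = 0"
    unfolding filt_sums_sub_family_iff[OF P_range subspace_0[OF subspace_A]]
    by (rule filt_sums_iff[OF filt_sums_P[OF exp_br_converges(2)[OF a x]]])
  then show ?thesis
    using a by (simp add: MC_def sub_family_def derived_brackets_def exp_term_def P_scale)
qed

section \<open>The Maurer-Cartan series on \<open>L[1] \<oplus> \<aa>\<close>\<close>

lemma graded_vector_space_shift_sum:
  "graded_vector_space (\<lambda>c. map_prod (scale c) (scale c)) (shift_sum_grading L A)"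
proof -
  interpret LA: vector_space "\<lambda>c. map_prod (scale c) (scale c)"
    by unfold_locales (auto simp: scale_right_distrib scale_left_distrib)
  show ?thesis
  proof
    show "LA.subspace (shift_sum_grading L A i)" for i
      using subspace_A subspace_component[of "i + 1"] subspace_component[of i]
      by (auto simp: LA.subspace_def subspace_def shift_sum_grading_def zero_prod_def)
  next
    fix I :: "int set" and f i
    assume I: "finite I" "\<And>i. i \<in> I \<Longrightarrow> f i \<in> shift_sum_grading L A i" "sum f I = 0" "i \<in> I"
    have f: "snd (f j) \<in> L j" "fst (f j) \<in> L (j + 1)" if "j \<in> I" for j
      using I(2)[OF that] by (auto simp: shift_sum_grading_def mem_Times_iff)
    have "snd (f i) = 0"
    proof (rule independent_components[of I "\<lambda>i. snd (f i)"])
      show "(\<Sum>i\<in>I. snd (f i)) = 0" using I(3) by (simp add: snd_sum[symmetric])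
    qed (use I(1,4) f in auto)
    \<comment> \<open>The first components have degrees shifted by one, so independence is applied
      over the shifted index set.\<close>
    moreover have "fst (f ((i + 1) - 1)) = 0"
    proof (rule independent_components[of "(\<lambda>i. i + 1) ` I" "\<lambda>j. fst (f (j - 1))"])
      show "(\<Sum>j\<in>(\<lambda>i. i + 1) ` I. fst (f (j - 1))) = 0"
        using I(3) by (simp add: sum.reindex fst_sum[symmetric])
    qed (use I(1,4) f in auto)
    ultimately show "f i = 0" by (simp add: prod_eq_iff)
  qed
qed

text \<open>All entries equal one element of degree 0, so the Koszul signs are trivial and the
  \<open>n + 1\<close> positions for the entry from \<open>L[1]\<close> give equal terms. The sign
  of \<open>[x, x]\<close> is \<open>- 1\<close> because \<open>|x| = 1\<close>.\<close>

lemma shift_sum_brackets_replicate_Suc: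
  assumes x: "x \<in> L 1" and a: "a \<in> A \<inter> L 0" and Q: "Q 0 = 0"
  shows "shift_sum_brackets scale L br A Q \<Delta> (replicate (Suc n) (x, a)) =
    (if n = 0 then - br \<Delta> x else if n = 1 then - br x x else 0,
      Q (foldl br \<Delta> (replicate (Suc n) a)) + scale (of_nat (Suc n)) (Q (foldl br x (replicate n a))))"
    (is "?lhs = ?rhs")
proof -
  interpret LA: graded_vector_space "\<lambda>c. map_prod (scale c) (scale c)" "shift_sum_grading L A"
    by (rule graded_vector_space_shift_sum)
  define ws where "ws = replicate (Suc n) (x, a)"
  have "map snd (take i ws @ drop (Suc i) ws) = replicate n a" if "i < Suc n" for i
    using that by (simp add: ws_def replicate_add[symmetric] del: replicate_Suc)
  then have "(\<Sum>i<length ws. scale ((- 1) powi (replicate (Suc n) 0 ! i * sum_list (take i (replicate (Suc n) 0))))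
      (Q (foldl br (fst (ws ! i)) (map snd (take i ws @ drop (Suc i) ws)))))
    = (\<Sum>i<Suc n. Q (foldl br x (replicate n a)))"
    by (intro sum.cong) (auto simp: ws_def nth_replicate simp del: replicate_Suc)
  also have "\<dots> = scale (of_nat (Suc n)) (Q (foldl br x (replicate n a)))"
    by (simp only: sum_constant_scale card_lessThan)
  finally have sum: "(\<Sum>i<length ws. scale ((- 1) powi (replicate (Suc n) 0 ! i * sum_list (take i (replicate (Suc n) 0))))
      (Q (foldl br (fst (ws ! i)) (map snd (take i ws @ drop (Suc i) ws)))))
    = scale (of_nat (Suc n)) (Q (foldl br x (replicate n a)))" .
  have hom: "shift_sum_brackets_hom scale br Q \<Delta> (replicate (Suc n) 0) (replicate (Suc n) (x, a)) = ?rhs"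
  proof -
    have "(case ws of [(x, a)] \<Rightarrow> - br \<Delta> x
         | [(x, a), (y, b)] \<Rightarrow> scale ((- 1) powi (hd (replicate (Suc n) 0) + 1)) (br x y) | _ \<Rightarrow> 0)
       = (if n = 0 then - br \<Delta> x else if n = 1 then - br x x else 0)"
    proof -
      consider "n = 0" | "n = 1" | m where "n = Suc (Suc m)"
        by (metis One_nat_def not0_implies_Suc)
      then show ?thesis by cases (auto simp: ws_def)
    qed
    moreover have "map snd ws = replicate (Suc n) a" by (simp add: ws_def)
    ultimately show ?thesis
      unfolding shift_sum_brackets_hom_def ws_def[symmetric] sum by (simp add: ws_def del: of_nat_Suc)
  qed
  have "?lhs = shift_sum_brackets_hom scale br Q \<Delta> (replicate (Suc n) 0) (replicate (Suc n) (x, a))"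
    unfolding shift_sum_brackets_def
  proof (rule LA.graded_ext_replicate)
    show "(x, a) \<in> shift_sum_grading L A 0" using x a by (simp add: shift_sum_grading_def)
    assume "(x, a) = 0"
    then have "x = 0" "a = 0" by (simp_all add: zero_prod_def)
    then show "shift_sum_brackets_hom scale br Q \<Delta> (replicate (Suc n) 0) (replicate (Suc n) (x, a)) = 0"
      unfolding hom by (simp add: Q zero_prod_def)
  qed
  then show ?thesis unfolding hom .
qed

lemma exp_br_zero: "a \<in> A \<inter> L 0 \<Longrightarrow> exp_br scale br F a 0 = 0"
  using exp_br_scale[of a 0 0 0] subspace_0[OF subspace_component] by simp

lemma MC_shift_sum_iff:
  assumes a: "a \<in> A \<inter> L 0" and Pa: "P (exp_br scale br F a \<Delta>) = 0"
    and x: "x \<in> L 1" and b: "b \<in> A \<inter> L 0"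
  shows "(x, b) \<in> MC_shift_sum scale L br A F (P \<circ> exp_br scale br F a) \<Delta> \<longleftrightarrow>
    br (\<Delta> + x) (\<Delta> + x) = 0 \<and> P (exp_br scale br F (a + b) (\<Delta> + x)) = 0"
proof -
  let ?E = "exp_br scale br F"
  define Q where "Q = P \<circ> ?E a"
  define m where "m n = map_prod (scale (inverse (fact n))) (scale (inverse (fact n)))
    (shift_sum_brackets scale L br A Q \<Delta> (replicate n (x, b)))" for n
  interpret LA: graded_vector_space "\<lambda>c. map_prod (scale c) (scale c)" "shift_sum_grading L A"
    by (rule graded_vector_space_shift_sum)
  have Q0: "Q 0 = 0" using exp_br_zero[OF a] by (simp add: Q_def)
  \<comment> \<open>Scalars are pulled out on homogeneous elements, where the exponential series has
    been shown to converge.\<close>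
  have Qs: "Q (scale c y) = scale c (Q y)" if "y \<in> L d" for c y d
    using exp_br_scale[OF a that] by (simp add: Q_def P_scale)
  have deg: "foldl br y (replicate n b) \<in> L 1" if "y \<in> L 1" for y n
    using that b foldl_br_degree[of "replicate n 0" "replicate n b" y 1]
    by (simp add: list_all2_conv_all_nth sum_list_replicate)
  have m0: "m 0 = 0"
    using LA.graded_ext_replicate[of "(x, b)" 0 "shift_sum_brackets_hom scale br Q \<Delta>" 0] x b
    by (simp add: m_def shift_sum_brackets_def shift_sum_grading_def shift_sum_brackets_hom_def
        zero_prod_def)
  have fst_m: "fst (m (Suc n)) = (if n = 0 then - br \<Delta> x else if n = 1 then - scale (1 / 2) (br x x) else 0)"
    for n
  proof -
    have "fst (m (Suc n)) = scale (inverse (fact (Suc n)))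
        (if n = 0 then - br \<Delta> x else if n = 1 then - br x x else 0)"
      by (simp only: m_def shift_sum_brackets_replicate_Suc[where Q = Q, OF x b Q0] fst_map_prod fst_conv)
    then show ?thesis by simp
  qed
  \<comment> \<open>Since \<open>(n + 1)/(n + 1)! = 1/n!\<close>, the terms in \<open>x\<close> form
    an exponential series that lags one index behind that of \<open>\<Delta>\<close>.\<close>
  have snd_m: "snd (m (Suc n)) = Q (exp_term b (Suc n) \<Delta>) + Q (exp_term b n x)" for n
  proof -
    have "inverse (fact (Suc n)) * of_nat (Suc n) = (inverse (fact n) :: 'k)"
      by (simp add: divide_simps del: of_nat_Suc)
    then show ?thesis
      unfolding m_def shift_sum_brackets_replicate_Suc[where Q = Q, OF x b Q0]
      by (simp add: exp_term_def Qs[OF deg[OF x]] Qs[OF deg[OF Delta_degree]] scale_right_distrib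
          del: replicate_Suc of_nat_Suc fact_Suc)
  qed
  \<comment> \<open>For two elements of degree 1 the bracket is symmetric.\<close>
  have "br \<Delta> x = br x \<Delta>"
    using br_antisymmetric[OF Delta_degree x] by simp
  then have square: "br (\<Delta> + x) (\<Delta> + x) = scale 2 (br \<Delta> x) + br x x"
    using scale_left_distrib[of 1 1 "br \<Delta> x"]
    by (simp add: br_add_left br_add_right Delta_square add.assoc)
  have "filt_sums F (\<lambda>n. fst (m n)) (\<Sum>n<3. fst (m n))"
  proof (rule filt_sums_finite)
    fix n :: nat assume "3 \<le> n"
    then obtain k where "n = Suc k" "2 \<le> k" by (cases n) auto
    then show "fst (m n) = 0" by (simp add: fst_m)
  qed
  \<comment> \<open>The terms are \<open>0\<close>, \<open>- [\<Delta>, x]\<close> and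
    \<open>- 1/2 [x, x]\<close>; the square is completed by
    \<open>[\<Delta>, \<Delta>] = 0\<close>.\<close>
  moreover have "(\<Sum>n<3. fst (m n)) = - scale (1 / 2) (br (\<Delta> + x) (\<Delta> + x))"
    unfolding square
    by (simp add: eval_nat_numeral m0 fst_m[of 0, simplified] fst_m[of 1, simplified] scale_right_distrib)
  ultimately have first: "filt_sums F (\<lambda>n. fst (m n)) 0 \<longleftrightarrow> br (\<Delta> + x) (\<Delta> + x) = 0"
    using filt_sums_iff[of "\<lambda>n. fst (m n)"] by simp
  have QE: "filt_sums F (\<lambda>n. Q (exp_term b n y)) (P (?E (a + b) y))" if "y \<in> L 1" for y
    unfolding Q_def comp_def by (intro filt_sums_P exp_br_exp_term_sums[OF a b that])
  \<comment> \<open>The series for \<open>\<Delta>\<close> starts at index 1. Its missing term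
    \<open>Q \<Delta>\<close> is zero by \<open>Pa\<close>, the Maurer-Cartan equation of
    \<open>a\<close>.\<close>
  have "filt_sums F (\<lambda>n. Q (exp_term b (Suc n) \<Delta>)) (P (?E (a + b) \<Delta>))"
    unfolding filt_sums_Suc_iff[of "\<lambda>n. Q (exp_term b n \<Delta>)"]
    using QE[OF Delta_degree] Pa by (simp add: Q_def)
  then have "filt_sums F (\<lambda>n. snd (m (Suc n))) (P (?E (a + b) \<Delta>) + P (?E (a + b) x))"
    unfolding snd_m by (rule filt_sums_add[OF _ QE[OF x]])
  moreover have ab: "a + b \<in> A \<inter> L 0"
    using a b subspace_add[OF subspace_A] subspace_add[OF subspace_component] by blast
  ultimately have "filt_sums F (\<lambda>n. snd (m n)) (P (?E (a + b) (\<Delta> + x)))"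
    unfolding filt_sums_Suc_iff[of "\<lambda>n. snd (m n)"] exp_br_add[OF ab Delta_degree x] P_add
    by (simp add: m0)
  then have second: "filt_sums F (\<lambda>n. snd (m n)) 0 \<longleftrightarrow> P (?E (a + b) (\<Delta> + x)) = 0"
    by (rule filt_sums_iff)
  have "snd (m n) \<in> A" for n
    by (cases n) (auto simp: m0 snd_m Q_def P_range subspace_0[OF subspace_A] subspace_add[OF subspace_A])
  then have "filt_sums (sub_family A F) (\<lambda>n. snd (m n)) 0 \<longleftrightarrow> filt_sums F (\<lambda>n. snd (m n)) 0"
    by (intro filt_sums_sub_family_iff subspace_0[OF subspace_A])
  moreover have "filt_sums (shift_sum_filtration F A) m 0
      \<longleftrightarrow> filt_sums F (\<lambda>n. fst (m n)) 0 \<and> filt_sums (sub_family A F) (\<lambda>n. snd (m n)) 0"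
    by (auto simp: filt_sums_def shift_sum_filtration_def sub_family_def mem_Times_iff fst_sum snd_sum
        eventually_conj_iff)
  moreover have "(x, b) \<in> shift_sum_grading L A 0" using x b by (simp add: shift_sum_grading_def)
  then have "(x, b) \<in> MC_shift_sum scale L br A F (P \<circ> ?E a) \<Delta> \<longleftrightarrow> filt_sums (shift_sum_filtration F A) m 0"
    by (simp add: MC_def m_def[abs_def] Q_def)
  ultimately show ?thesis using first second by simp
qed

end

theorem theorem3:
  fixes scale :: "'k::field_char_0 \<Rightarrow> 'v::ab_group_add \<Rightarrow> 'v"
    and L :: "int \<Rightarrow> 'v set" and br :: "'v \<Rightarrow> 'v \<Rightarrow> 'v"
    and A :: "'v set" and P :: "'v \<Rightarrow> 'v" and \<Delta> \<Phi> \<Delta>' \<Phi>' :: 'v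
    and F :: "int \<Rightarrow> 'v set"
  assumes "filtered_V_data scale L br A P \<Delta> F"
    and "\<Phi> \<in> MC_derived scale L br A F P \<Delta>"
    and "\<Delta>' \<in> L 1"
    and "\<Phi>' \<in> A \<inter> L 0"
  shows "((br (\<Delta> + \<Delta>') (\<Delta> + \<Delta>') = 0 \<and> \<Phi> + \<Phi>' \<in> MC_derived scale L br A F P (\<Delta> + \<Delta>'))
        \<longleftrightarrow> (\<Delta>', \<Phi>') \<in> MC_shift_sum scale L br A F (P \<circ> exp_br scale br F \<Phi>) \<Delta>)
    \<and> (br (\<Delta> + \<Delta>') (\<Delta> + \<Delta>') = 0 \<and> \<Phi> + \<Phi>' \<in> MC_derived scale L br A F P (\<Delta> + \<Delta>') \<longrightarrow>
        curved_Linfty1_algebra scale (sub_family A L) (derived_brackets br P (\<Delta> + \<Delta>'))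
        \<and> (Linfty1_algebra scale (sub_family A L) (derived_brackets br P (\<Delta> + \<Delta>'))
            \<longleftrightarrow> P \<Delta>' = 0))"
proof -
  interpret filtered_V_data scale L br A P \<Delta> F by (rule assms(1))
  have phi: "\<Phi> \<in> A \<inter> L 0" using assms(2) by (simp add: MC_def sub_family_def)
  have sum_phi: "\<Phi> + \<Phi>' \<in> A \<inter> L 0"
    using phi assms(4) subspace_add[OF subspace_A] subspace_add[OF subspace_component] by blast
  have sum_delta: "\<Delta> + \<Delta>' \<in> L 1"
    using Delta_degree assms(3) by (rule subspace_add[OF subspace_component])
  have "P (exp_br scale br F \<Phi> \<Delta>) = 0"
    using assms(2) MC_derived_iff[OF phi Delta_degree] by blast
  then have iff: "(br (\<Delta> + \<Delta>') (\<Delta> + \<Delta>') = 0 \<and> \<Phi> + \<Phi>' \<in> MC_derived scale L br A F P (\<Delta> + \<Delta>'))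
        \<longleftrightarrow> (\<Delta>', \<Phi>') \<in> MC_shift_sum scale L br A F (P \<circ> exp_br scale br F \<Phi>) \<Delta>"
    unfolding MC_derived_iff[OF sum_phi sum_delta]
    using MC_shift_sum_iff[OF phi _ assms(3,4)] by blast
  have "curved_Linfty1_algebra scale (sub_family A L) (derived_brackets br P (\<Delta> + \<Delta>'))
        \<and> (Linfty1_algebra scale (sub_family A L) (derived_brackets br P (\<Delta> + \<Delta>'))
            \<longleftrightarrow> P \<Delta>' = 0)" if "br (\<Delta> + \<Delta>') (\<Delta> + \<Delta>') = 0"
  proof -
    interpret D: curved_V_data scale L br A P "\<Delta> + \<Delta>'"
      by unfold_locales
        (fact graded_subspace_A abelian P_add P_scale P_degree P_range P_id ker_P_subalgebra sum_delta that)+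
    interpret D: curved_Linfty1_algebra scale "sub_family A L" "derived_brackets br P (\<Delta> + \<Delta>')"
      by (rule D.curved_Linfty1_algebra_derived_brackets)
    \<comment> \<open>As \<open>P \<Delta> = 0\<close>, the curvature of the new brackets is exactly
      \<open>P \<Delta>'\<close>.\<close>
    have "derived_brackets br P (\<Delta> + \<Delta>') [] = P \<Delta>'"
      by (simp add: derived_brackets_def P_add Delta_ker)
    then show ?thesis
      using D.Linfty1_algebra_iff_no_curvature D.curved_Linfty1_algebra_axioms by simp
  qed
  then show ?thesis using iff by blast
qed

end
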